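(* Let $\mathcal H$ be a real Hilbert space and let $\gamma>0$. Assume: (a) $\phi:\mathcal H\to\mathbb R$ is a convex differentiable function whose gradient $\nabla\phi$ is Lipschitz continuous on bounded sets; (b) $A:\mathcal H\to\mathcal H$ is maximal monotone and $\lambda$-cocoercive for some $\lambda>0$; (c) $\varepsilon:[0,+\infty)\to(0,+\infty)$ is of class $C^1$ and $\varepsilon(t)\to0$ as $t\to+\infty$; (d) $\Theta:\mathcal H\to\mathbb R$ is differentiable, convex and bounded below on $\mathcal H$, and there are $\delta>0$, $\eta>0$ such that $|\nabla\Theta(u)-\nabla\Theta(v)|\le\delta|u-v|$ and $\langle\nabla\Theta(u)-\nabla\Theta(v),u-v\rangle\ge\eta|u-v|^2$ for all $u,v\in\mathcal H$. Suppose that $S:=(A+\nabla\phi)^{-1}(0)=\{v\in\mathcal H: Av+\nabla\phi(v)=0\}\ne\emptyset$, that $\lambda\gamma^2>1$, that $\varepsilon(\cdot)$ is decreasing, and that $$\int_0^{+\infty}\varepsilon(s)\,ds=+\infty .$$ Then, for any $u_0,v_0\in\mathcal H$, there exists a unique solution $u\in C^2([0,+\infty);\mathcal H)$ of $$\ddot u(t)+\gamma\dot u(t)+\nabla\phi(u(t))+A(u(t))+\varepsilon(t)\nabla\Theta(u(t))=0,\qquad u(0)=u_0,\ \dot u(0)=v_0,$$ and it satisfies $u(t)\to u_*$ strongly in $\mathcal H$ as $t\to+\infty$, where $u_*$ is the unique solution of the variational inequality: find $u_*\in S$ such that $$\langle\nabla\Theta(u_* ),v-u_*\rangle\ge0\qquad\forall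 v\in S.$$
   Context: $\langle\cdot,\cdot\rangle$ and $|\cdot|$ denote the scalar product and norm of $\mathcal H$. An operator $A:\mathcal H\to\mathcal H$ (single-valued, everywhere defined) is $\lambda$-cocoercive, $\lambda>0$, if $\langle Av-Aw,v-w\rangle\ge\lambda|Av-Aw|^2$ for all $v,w\in\mathcal H$. Dots denote derivatives with respect to time $t$. *)

theory Defs
  imports "HOL-Analysis.Analysis"
begin

definition monotone_graph :: "('a::real_inner \<times> 'a) set \<Rightarrow> bool" where
  "monotone_graph G \<longleftrightarrow>
     (\<forall>(v, v')\<in>G. \<forall>(w, w')\<in>G. (v' - w') \<bullet> (v - w) \<ge> 0)"

(* Maximality is taken among all set-valued monotone operators, identified with their graphs. *)
definition maximal_monotone :: "('a::real_inner \<Rightarrow> 'a) \<Rightarrow> bool" where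
  "maximal_monotone A \<longleftrightarrow>
     monotone_graph {(v, A v) | v. True} \<and>
     (\<forall>G. monotone_graph G \<and> {(v, A v) | v. True} \<subseteq> G \<longrightarrow> G = {(v, A v) | v. True})"

definition cocoercive :: "real \<Rightarrow> ('a::real_inner \<Rightarrow> 'a) \<Rightarrow> bool" where
  "cocoercive lam A \<longleftrightarrow>
     lam > 0 \<and> (\<forall>v w. (A v - A w) \<bullet> (v - w) \<ge> lam * (norm (A v - A w))\<^sup>2)"

(* Functions on [0,+oo) are represented by total functions on the reals whose values at
   negative arguments are irrelevant; derivatives are relative to {0..}, hence one-sided at 0. *)
definition C1_halfline :: "(real \<Rightarrow> real) \<Rightarrow> bool" where
  "C1_halfline f \<longleftrightarrow>
     (\<exists>f'. (\<forall>t\<ge>0. (f has_real_derivative f' t) (at t within {0..})) \<and> continuous_on {0..} f')"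

(* u is a C^2 solution on [0,+oo) of
     u'' + \<gamma> u' + g\<phi>(u) + A(u) + \<epsilon>(t) g\<Theta>(u) = 0,  u(0) = u0,  u'(0) = v0,
   where g\<phi> and g\<Theta> play the role of the gradients of \<phi> and \<Theta>. *)
definition is_solution ::
  "real \<Rightarrow> ('a::real_inner \<Rightarrow> 'a) \<Rightarrow> ('a \<Rightarrow> 'a) \<Rightarrow> (real \<Rightarrow> real) \<Rightarrow> ('a \<Rightarrow> 'a)
     \<Rightarrow> 'a \<Rightarrow> 'a \<Rightarrow> (real \<Rightarrow> 'a) \<Rightarrow> bool" where
  "is_solution \<gamma> g\<phi> A \<epsilon> g\<Theta> u0 v0 u \<longleftrightarrow>
     (\<exists>u' u''.
        (\<forall>t\<ge>0. (u has_vector_derivative u' t) (at t within {0..})) \<and>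
        (\<forall>t\<ge>0. (u' has_vector_derivative u'' t) (at t within {0..})) \<and>
        continuous_on {0..} u'' \<and>
        (\<forall>t\<ge>0. u'' t + \<gamma> *\<^sub>R u' t + g\<phi> (u t) + A (u t) + \<epsilon> t *\<^sub>R g\<Theta> (u t) = 0) \<and>
        u 0 = u0 \<and> u' 0 = v0)"

definition solves_VI :: "('a::real_inner \<Rightarrow> 'a) \<Rightarrow> 'a set \<Rightarrow> 'a \<Rightarrow> bool" where
  "solves_VI F S x \<longleftrightarrow> x \<in> S \<and> (\<forall>v\<in>S. F x \<bullet> (v - x) \<ge> 0)"

end

theory Submission
  imports Defs
begin

text \<open>
  Let \<open>p\<close> be the solution of the variational inequality, \<open>x = u - p\<close>, \<open>y = u'\<close>, \<open>a = A u - A p\<close>, and let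
  \<open>D\<close> be the Bregman distance of \<open>\<phi>\<close> from \<open>p\<close>. The condition \<open>\<lambda>\<gamma>\<^sup>2 > 1\<close> makes a quadratic form in
  \<open>(y, a)\<close> positive definite, so that along solutions the Lyapunov function
  \<open>V = D(u) + |y|\<^sup>2/2 + (\<gamma>/2) <x, y> + (\<gamma>/2)\<^sup>2 |x|\<^sup>2\<close> satisfies, once \<open>\<epsilon>\<close> is small,
  \<open>V' \<le> - \<kappa> \<epsilon> V - c (|a|\<^sup>2 + D(u)) - (\<gamma>/2) \<epsilon> <\<nabla>\<Theta>(p), x> + O(\<epsilon>\<^sup>2)\<close>.
  Hence \<open>V\<close> is bounded, which also yields global existence. If \<open><\<nabla>\<Theta>(p), x>\<close> is at most a
  negative constant then, \<open>u\<close> being bounded, the residual \<open>|a|\<^sup>2 + D(u)\<close> is bounded away from zero and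
  absorbs the term of order \<open>\<epsilon>\<close>. So \<open>V' \<le> - \<kappa> \<epsilon> V + o(\<epsilon>)\<close>, and \<open>V\<close> tends to \<open>0\<close> because
  \<open>\<epsilon>\<close> is not integrable.
\<close>

subsection \<open>Convexity and variational inequalities\<close>

text \<open>Restricting \<open>f\<close> to the line through \<open>x\<close> and \<open>y\<close>
  reduces this to the tangent inequality for a convex function of one real variable.\<close>

lemma convex_on_gderiv_above_tangent:
  fixes f :: "'a::real_inner \<Rightarrow> real"
  assumes "convex_on UNIV f" and "GDERIV f x :> g"
  shows "f x + g \<bullet> (y - x) \<le> f y"
proof -
  define l where "l = (\<lambda>t::real. f (x + t *\<^sub>R (y - x)))"
  have "convex_on UNIV l"
  proof (rule convex_onI)
    fix t a b :: real
    assume t: "0 < t" "t < 1"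
    have "x + ((1 - t) *\<^sub>R a + t *\<^sub>R b) *\<^sub>R (y - x) =
        (1 - t) *\<^sub>R (x + a *\<^sub>R (y - x)) + t *\<^sub>R (x + b *\<^sub>R (y - x))"
      by (simp add: algebra_simps)
    then show "l ((1 - t) *\<^sub>R a + t *\<^sub>R b) \<le> (1 - t) * l a + t * l b"
      unfolding l_def using convex_onD[OF assms(1), of t] t by simp
  qed auto
  moreover have "(l has_real_derivative g \<bullet> (y - x)) (at 0)"
  proof -
    have 1: "((\<lambda>t::real. x + t *\<^sub>R (y - x)) has_derivative (\<lambda>t. t *\<^sub>R (y - x))) (at 0)"
      by (auto intro!: derivative_eq_intros)
    have 2: "(f has_derivative (\<lambda>h. h \<bullet> g)) (at (x + 0 *\<^sub>R (y - x)))"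
      using assms(2) by (simp add: gderiv_def)
    show ?thesis
      using has_derivative_compose[OF 1 2]
      by (simp add: l_def has_field_derivative_def inner_commute mult.commute[of _ "inner _ _"] fun_eq_iff)
  qed
  ultimately have "l 1 - l 0 \<ge> g \<bullet> (y - x) * (1 - 0)"
    by (intro convex_on_imp_above_tangent[of UNIV]) auto
  then show ?thesis
    by (simp add: l_def)
qed

lemma GDERIV_chain_vector:
  assumes "GDERIV f (u t) :> g" and "(u has_vector_derivative u') (at t within X)"
  shows "((\<lambda>s. f (u s)) has_real_derivative g \<bullet> u') (at t within X)"
proof -
  have "((\<lambda>s. f (u s)) has_derivative (\<lambda>h. (h *\<^sub>R u') \<bullet> g)) (at t within X)"
    using has_derivative_compose[OF assms(2)[unfolded has_vector_derivative_def], of f]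
      assms(1)[unfolded gderiv_def] by blast
  then show ?thesis
    by (simp add: has_field_derivative_def inner_commute mult.commute[of _ "inner _ _"])
qed

text \<open>Minty's trick: test the hypothesis at the points \<open>v + t (w - v)\<close>, divide by
  \<open>t > 0\<close>, and let \<open>t\<close> tend to 0.\<close>

lemma minty_variational:
  fixes F :: "'a::real_inner \<Rightarrow> 'a"
  assumes "convex S" and F: "continuous_on S F" and "v \<in> S" "w \<in> S"
    and minty: "\<And>w. w \<in> S \<Longrightarrow> F w \<bullet> (w - v) \<ge> 0"
  shows "F v \<bullet> (w - v) \<ge> 0"
proof -
  define p where "p = (\<lambda>t::real. v + t *\<^sub>R (w - v))"
  have p: "p t \<in> S" if "t \<in> {0..1}" for t
  proof -
    have "(1 - t) *\<^sub>R v + t *\<^sub>R w \<in> S"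
      using that assms by (intro convexD) auto
    then show ?thesis by (simp add: p_def algebra_simps)
  qed
  have "continuous_on {0..1} (\<lambda>t. F (p t))"
    by (rule continuous_on_compose2[OF F]) (use p in \<open>auto simp: p_def intro!: continuous_intros\<close>)
  then have "((\<lambda>t. F (p t) \<bullet> (w - v)) \<longlongrightarrow> F (p 0) \<bullet> (w - v)) (at 0 within {0..1})"
    by (auto simp: continuous_on_def intro!: tendsto_intros)
  moreover have "at (0::real) within {0..1} \<noteq> bot"
    by (simp add: at_within_Icc_at_right)
  moreover have "\<forall>\<^sub>F t in at 0 within {0..1}. F (p t) \<bullet> (w - v) \<ge> 0"
  proof (unfold eventually_at_filter, intro always_eventually allI impI)
    fix t :: real assume t: "t \<noteq> 0" "t \<in> {0..1}"
    have "t * (F (p t) \<bullet> (w - v)) \<ge> 0"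
      using minty[OF p[OF t(2)]] by (simp add: p_def)
    then show "F (p t) \<bullet> (w - v) \<ge> 0"
      using t by (simp add: zero_le_mult_iff)
  qed
  ultimately have "0 \<le> F (p 0) \<bullet> (w - v)"
    using tendsto_lowerbound by blast
  then show ?thesis by (simp add: p_def)
qed

text \<open>Stands in for weak compactness: points of nearly minimal norm in the sets
  \<open>C n\<close> form a Cauchy sequence by the parallelogram law, and the limit lies in every
  \<open>C n\<close>.\<close>

lemma nested_closed_convex_nonempty:
  fixes C :: "nat \<Rightarrow> 'a::{real_inner, banach} set"
  assumes dec: "decseq C" and cl: "\<And>n. closed (C n)" and cv: "\<And>n. convex (C n)"
    and ne: "\<And>n. C n \<noteq> {}" and bd: "bounded (C 0)"
  shows "(\<Inter>n. C n) \<noteq> {}"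
proof -
  define s where "s = (\<lambda>n. INF x\<in>C n. (norm x)\<^sup>2)"
  have bb: "bdd_below ((\<lambda>x. (norm x)\<^sup>2) ` C n)" for n
    by (rule bdd_belowI[of _ 0]) auto
  have s_le: "s n \<le> (norm x)\<^sup>2" if "x \<in> C n" for n x
    unfolding s_def using that bb by (intro cINF_lower) auto
  have "\<exists>x\<in>C n. (norm x)\<^sup>2 < s n + 1 / Suc n" for n
  proof -
    have "s n < s n + 1 / Suc n" by simp
    then show ?thesis
      using cINF_less_iff[OF ne bb] unfolding s_def by blast
  qed
  then obtain x where xC: "\<And>n. x n \<in> C n" and x: "\<And>n. (norm (x n))\<^sup>2 < s n + 1 / Suc n"
    by metis
  have sub: "C n \<subseteq> C m" if "m \<le> n" for m n
    using dec that by (auto simp: decseq_def)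
  \<comment> \<open>The squared distances from the origin grow as the sets shrink; boundedness of
    \<open>C 0\<close> caps them.\<close>
  have inc: "incseq s"
    unfolding incseq_def s_def using sub ne bb by (auto intro!: cINF_superset_mono)
  obtain R where R: "\<And>y. y \<in> C 0 \<Longrightarrow> norm y \<le> R"
    using bd unfolding bounded_iff by auto
  have "s n \<le> R\<^sup>2" for n
  proof -
    have "norm (x n) \<le> R" using R sub[of 0 n] xC by auto
    then have "(norm (x n))\<^sup>2 \<le> R\<^sup>2" by (intro power_mono) auto
    then show ?thesis using s_le[OF xC, of n] by linarith
  qed
  then have "\<exists>L. s \<longlonglongrightarrow> L \<and> (\<forall>n. s n \<le> L)"
    using incseq_convergent[OF inc] by blast
  then obtain L where sL: "s \<longlonglongrightarrow> L" "\<And>n. s n \<le> L" by blast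
  \<comment> \<open>The midpoint of \<open>x n\<close> and \<open>x m\<close> lies in
    \<open>C n\<close>, so its squared norm is at least \<open>s n\<close>; the parallelogram law
    turns this into closeness of the two points.\<close>
  have par: "(norm (x n - x m))\<^sup>2 \<le> 2 * (L - s n) + 4 * (1 / Suc n)" if "n \<le> m" for n m
  proof -
    have "(1/2) *\<^sub>R x n + (1/2) *\<^sub>R x m \<in> C n"
      using xC sub[OF that] by (intro convexD[OF cv]) auto
    then have "s n \<le> (norm ((1/2) *\<^sub>R x n + (1/2) *\<^sub>R x m))\<^sup>2" by (rule s_le)
    moreover have "(norm (x n - x m))\<^sup>2 = 2 * (norm (x n))\<^sup>2 + 2 * (norm (x m))\<^sup>2
        - 4 * (norm ((1/2) *\<^sub>R x n + (1/2) *\<^sub>R x m))\<^sup>2"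
      unfolding power2_norm_eq_inner by (simp add: algebra_simps inner_commute)
    moreover have "1 / real (Suc m) \<le> 1 / real (Suc n)"
      using that by (simp add: frac_le)
    ultimately show ?thesis
      using x[of n] x[of m] sL(2)[of m] by argo
  qed
  have "Cauchy x"
  proof (rule metric_CauchyI)
    fix e :: real assume e: "e > 0"
    have "(\<lambda>n. 2 * (L - s n) + 4 * (1 / Suc n)) \<longlonglongrightarrow> 2 * (L - L) + 4 * 0"
      by (intro tendsto_intros sL(1) LIMSEQ_Suc[OF lim_1_over_n])
    then have "\<forall>\<^sub>F n in sequentially. 2 * (L - s n) + 4 * (1 / Suc n) < (e/2)\<^sup>2"
      using e by (intro order_tendstoD) auto
    then obtain N where N: "2 * (L - s N) + 4 * (1 / Suc N) < (e/2)\<^sup>2"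
      by (auto simp: eventually_sequentially)
    have d: "norm (x N - x m) < e/2" if "m \<ge> N" for m
    proof (rule power2_less_imp_less)
      show "(norm (x N - x m))\<^sup>2 < (e/2)\<^sup>2" using par[OF that] N by linarith
    qed (use e in auto)
    show "\<exists>M. \<forall>m\<ge>M. \<forall>n\<ge>M. dist (x m) (x n) < e"
    proof (intro exI allI impI)
      fix m n assume "N \<le> m" "N \<le> n"
      then show "dist (x m) (x n) < e"
        using dist_triangle_half_l[of "x m" "x N" e "x n"] d[of m] d[of n]
        by (simp add: dist_norm norm_minus_commute)
    qed
  qed
  then obtain v where v: "x \<longlonglongrightarrow> v"
    using Cauchy_convergent convergent_def by blast
  have "v \<in> C n" for n
  proof (rule closed_sequentially[OF cl])
    show "x (i + n) \<in> C n" for i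
      using xC[of "i + n"] sub[of n "i + n"] by auto
    show "(\<lambda>i. x (i + n)) \<longlonglongrightarrow> v"
      by (rule LIMSEQ_ignore_initial_segment[OF v])
  qed
  then show ?thesis by blast
qed

text \<open>The solution is a minimiser of \<Theta> on \<open>S\<close>, found as a common point of
  the sublevel sets \<open>C n\<close>. Strong monotonicity of \<open>g\<close> makes these
  bounded.\<close>

lemma variational_inequality_exists:
  fixes \<Theta> :: "'a::{real_inner, banach} \<Rightarrow> real"
  assumes S: "closed S" "convex S" "S \<noteq> {}"
    and grad: "\<And>x. GDERIV \<Theta> x :> g x" and conv: "convex_on UNIV \<Theta>"
    and bdd: "bdd_below (range \<Theta>)" and g: "continuous_on S g" and "\<eta> > 0"
    and strong: "\<And>u v. (g u - g v) \<bullet> (u - v) \<ge> \<eta> * (norm (u - v))\<^sup>2"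
  shows "\<exists>x. solves_VI g S x"
proof -
  note tangent = convex_on_gderiv_above_tangent[OF conv grad]
  define m where "m = Inf (\<Theta> ` S)"
  have bb: "bdd_below (\<Theta> ` S)" by (rule bdd_below_mono[OF bdd]) auto
  have m: "m \<le> \<Theta> x" if "x \<in> S" for x
    unfolding m_def using that bb by (intro cINF_lower) auto
  define C where "C = (\<lambda>n. S \<inter> {x. \<Theta> x \<le> m + 1 / real (Suc n)})"
  obtain p where p: "p \<in> S" using S by blast
  \<comment> \<open>The constant is not optimal; it comes from two tangent inequalities through the midpoint.\<close>
  have growth: "\<Theta> p + g p \<bullet> (x - p) + \<eta> / 4 * (norm (x - p))\<^sup>2 \<le> \<Theta> x" for x
  proof -
    define h where "h = (1/2) *\<^sub>R (x - p)"
    have x: "x = p + 2 *\<^sub>R h" by (simp add: h_def)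
    have "\<Theta> (p + h) + g (p + h) \<bullet> h \<le> \<Theta> x" "\<Theta> p + g p \<bullet> h \<le> \<Theta> (p + h)"
      using tangent[of "p + h" x] tangent[of p "p + h"] by (simp_all add: x scaleR_2)
    moreover have "g (p + h) \<bullet> h \<ge> g p \<bullet> h + \<eta> * (norm h)\<^sup>2"
      using strong[of "p + h" p] by (simp add: algebra_simps)
    ultimately show ?thesis by (simp add: x power_mult_distrib)
  qed
  have "(\<Inter>n. C n) \<noteq> {}"
  proof (rule nested_closed_convex_nonempty)
    show "decseq C"
      unfolding decseq_def C_def
    proof (intro allI impI Int_mono order_refl Collect_mono)
      fix i j x assume "i \<le> j" "\<Theta> x \<le> m + 1 / real (Suc j)"
      moreover have "1 / real (Suc j) \<le> 1 / real (Suc i)"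
        using \<open>i \<le> j\<close> by (simp add: frac_le)
      ultimately show "\<Theta> x \<le> m + 1 / real (Suc i)" by linarith
    qed
    have "continuous_on UNIV \<Theta>"
      using grad by (auto simp: gderiv_def continuous_on_eq_continuous_at intro: has_derivative_continuous)
    then show "closed (C n)" for n
      unfolding C_def by (intro closed_Int S(1) closed_Collect_le continuous_intros) auto
    show "convex (C n)" for n
      unfolding C_def
    proof (intro convex_Int S(2) convexI CollectI)
      fix x y :: 'a and a b :: real
      assume x: "x \<in> {x. \<Theta> x \<le> m + 1 / real (Suc n)}" and y: "y \<in> {x. \<Theta> x \<le> m + 1 / real (Suc n)}"
        and ab: "0 \<le> a" "0 \<le> b" "a + b = 1"
      have "\<Theta> (a *\<^sub>R x + b *\<^sub>R y) \<le> a * \<Theta> x + b * \<Theta> y"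
        using conv ab by (auto simp: convex_on_def)
      also have "\<dots> \<le> m + 1 / real (Suc n)"
        using x y ab by (intro convex_bound_le) auto
      finally show "\<Theta> (a *\<^sub>R x + b *\<^sub>R y) \<le> m + 1 / real (Suc n)" .
    qed
    show "C n \<noteq> {}" for n
    proof -
      have "m < m + 1 / real (Suc n)" by simp
      then obtain x where "x \<in> S" "\<Theta> x < m + 1 / real (Suc n)"
        unfolding m_def using cINF_less_iff[OF S(3) bb] by blast
      then show ?thesis by (auto simp: C_def intro!: exI[of _ x])
    qed
    show "bounded (C 0)"
    proof (rule boundedI)
      fix x assume "x \<in> C 0"
      then have le: "\<Theta> x \<le> m + 1" by (simp add: C_def)
      define r a where "r = norm (x - p)" and "a = \<bar>m + 1 - \<Theta> p\<bar> + norm (g p)"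
      \<comment> \<open>When \<open>r > 1\<close>, the constant term of the quadratic inequality is
        at most itself times \<open>r\<close>, so dividing by \<open>r\<close> leaves a linear
        bound.\<close>
      have "r \<le> 1 + 4 / \<eta> * a"
      proof (cases "r \<le> 1")
        case True
        have "4 / \<eta> * a \<ge> 0" using \<open>\<eta> > 0\<close> by (simp add: a_def)
        with True show ?thesis by linarith
      next
        case False
        have "\<eta> / 4 * r\<^sup>2 \<le> \<bar>m + 1 - \<Theta> p\<bar> + norm (g p) * r"
          using growth[of x] le Cauchy_Schwarz_ineq2[of "g p" "x - p"] unfolding r_def by linarith
        also have "\<dots> \<le> a * r"
          using False mult_left_mono[of 1 r "\<bar>m + 1 - \<Theta> p\<bar>"] by (simp add: a_def algebra_simps)
        finally have "(\<eta> / 4 * r) * r \<le> a * r" by (simp add: power2_eq_square mult_ac)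
        then have "\<eta> / 4 * r \<le> a" using False by (simp add: mult_le_cancel_right)
        then show ?thesis using \<open>\<eta> > 0\<close> by (simp add: field_simps)
      qed
      then show "norm x \<le> norm p + (1 + 4 / \<eta> * a)"
        using norm_triangle_sub[of x p] by (simp add: r_def)
    qed
  qed
  then obtain x where x: "\<And>n. x \<in> C n" by blast
  then have "x \<in> S" by (auto simp: C_def)
  have "\<Theta> x \<le> m"
  proof (rule LIMSEQ_le_const[of "\<lambda>n. m + 1 / real (Suc n)"])
    show "(\<lambda>n. m + 1 / real (Suc n)) \<longlonglongrightarrow> m"
      using tendsto_add[OF tendsto_const[of m] LIMSEQ_Suc[OF lim_1_over_n]] by simp
    show "\<exists>N. \<forall>n\<ge>N. \<Theta> x \<le> m + 1 / real (Suc n)" using x by (auto simp: C_def)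
  qed
  \<comment> \<open>Minimality and the tangent at \<open>w\<close> give
    \<open>g w \<bullet> (x - w) \<le> \<Theta> x - \<Theta> w \<le> 0\<close>, which is the Minty
    form of the inequality.\<close>
  have "g x \<bullet> (w - x) \<ge> 0" if "w \<in> S" for w
  proof (rule minty_variational[OF S(2) g \<open>x \<in> S\<close> that])
    fix w assume "w \<in> S"
    then show "g w \<bullet> (w - x) \<ge> 0"
      using tangent[of w x] m[of w] \<open>\<Theta> x \<le> m\<close> by (simp add: inner_diff_right)
  qed
  then show ?thesis using \<open>x \<in> S\<close> by (auto simp: solves_VI_def)
qed

lemma variational_inequality_unique:
  assumes "\<eta> > 0" and strong: "\<And>u v. (g u - g v) \<bullet> (u - v) \<ge> \<eta> * (norm (u - v))\<^sup>2"
    and x: "solves_VI g S x" and y: "solves_VI g S y"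
  shows "x = y"
proof -
  have "g x \<bullet> (y - x) \<ge> 0" "g y \<bullet> (x - y) \<ge> 0"
    using x y by (auto simp: solves_VI_def)
  then have "\<eta> * (norm (x - y))\<^sup>2 \<le> 0"
    using strong[of x y] by (simp add: algebra_simps)
  then show ?thesis using \<open>\<eta> > 0\<close> by (simp add: mult_le_0_iff)
qed

subsection \<open>Differential inequalities and global existence\<close>

text \<open>Gronwall's inequality in differential form: the product \<open>g t * exp (K t)\<close>
  has nonpositive derivative.\<close>

lemma integrating_factor_decreasing:
  fixes g K :: "real \<Rightarrow> real"
  assumes "a \<le> b"
    and g: "\<And>t. t \<in> {a..b} \<Longrightarrow> (g has_real_derivative g' t) (at t within {a..b})"
    and K: "\<And>t. t \<in> {a..b} \<Longrightarrow> (K has_real_derivative k t) (at t within {a..b})"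
    and le: "\<And>t. t \<in> {a..b} \<Longrightarrow> g' t \<le> - k t * g t"
  shows "g b * exp (K b) \<le> g a * exp (K a)"
proof (cases "a = b")
  case False
  then have "a < b" using \<open>a \<le> b\<close> by simp
  have "((\<lambda>t. g t * exp (K t)) has_derivative (\<lambda>h. (g' t + k t * g t) * exp (K t) * h))
      (at t within {a..b})" if "a \<le> t" "t \<le> b" for t
    using g[of t] K[of t] that unfolding has_field_derivative_def[symmetric]
    by (auto intro!: derivative_eq_intros simp: algebra_simps)
  from mvt_simple[OF \<open>a < b\<close> this] obtain t where t: "t \<in> {a<..<b}"
    "g b * exp (K b) - g a * exp (K a) = (g' t + k t * g t) * exp (K t) * (b - a)" by blast
  have "(g' t + k t * g t) * exp (K t) * (b - a) \<le> 0"
    using le[of t] t(1) by (intro mult_nonpos_nonneg) auto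
  then show ?thesis using t(2) by linarith
qed auto

text \<open>With \<open>E\<close> as time variable, \<open>g\<close> relaxes at rate \<kappa>
  towards the level \<open>C / \<kappa>\<close>; subtracting that level makes the inequality
  homogeneous.\<close>

lemma relaxation_bound:
  fixes g E :: "real \<Rightarrow> real"
  assumes "a \<le> b" and \<kappa>: "\<kappa> > 0"
    and g: "\<And>t. t \<in> {a..b} \<Longrightarrow> (g has_real_derivative g' t) (at t within {a..b})"
    and E: "\<And>t. t \<in> {a..b} \<Longrightarrow> (E has_real_derivative e t) (at t within {a..b})"
    and le: "\<And>t. t \<in> {a..b} \<Longrightarrow> g' t \<le> - \<kappa> * e t * g t + C * e t"
  shows "g b \<le> C / \<kappa> + (g a - C / \<kappa>) * exp (- \<kappa> * (E b - E a))"
proof -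
  have "(g b - C / \<kappa>) * exp (\<kappa> * E b) \<le> (g a - C / \<kappa>) * exp (\<kappa> * E a)"
  proof (rule integrating_factor_decreasing[OF \<open>a \<le> b\<close>])
    fix t assume t: "t \<in> {a..b}"
    show "((\<lambda>t. g t - C / \<kappa>) has_real_derivative g' t) (at t within {a..b})"
      using g[OF t] by (auto intro!: derivative_eq_intros)
    show "((\<lambda>t. \<kappa> * E t) has_real_derivative \<kappa> * e t) (at t within {a..b})"
      by (rule DERIV_cmult[OF E[OF t]])
    show "g' t \<le> - (\<kappa> * e t) * (g t - C / \<kappa>)"
      using le[OF t] \<kappa> by (simp add: algebra_simps)
  qed
  then have "(g b - C / \<kappa>) * exp (\<kappa> * E b) * exp (- \<kappa> * E b)
      \<le> (g a - C / \<kappa>) * exp (\<kappa> * E a) * exp (- \<kappa> * E b)"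
    by (rule mult_right_mono) simp
  moreover have "exp (\<kappa> * E b) * exp (- \<kappa> * E b) = 1"
    "exp (\<kappa> * E a) * exp (- \<kappa> * E b) = exp (- \<kappa> * (E b - E a))"
    by (simp_all add: algebra_simps flip: exp_add)
  ultimately show ?thesis by (simp only: mult.assoc mult_1_right diff_le_eq add.commute)
qed

text \<open>Serves the continuation argument in \<open>solution_exists\<close>: up to time
  \<open>s\<close> the trajectory has not left the ball of radius \<open>R\<close>.\<close>

lemma first_hitting_time:
  fixes f :: "real \<Rightarrow> real"
  assumes "continuous_on {0..b} f" "f 0 < R" "R \<le> f b" "0 \<le> b"
  obtains s where "s \<in> {0..b}" "f s = R" "\<And>t. t \<in> {0..s} \<Longrightarrow> f t \<le> R"
proof -
  define B where "B = {0..b} \<inter> f -` {R..}"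
  have "compact B"
    unfolding B_def using continuous_closed_preimage[OF assms(1)] compact_Int_closed
    by (metis bounded_closed_interval bounded_subset closed_atLeastAtMost closed_atLeast compact_eq_bounded_closed inf_le1)
  moreover have "b \<in> B" using assms by (auto simp: B_def)
  ultimately obtain s where s: "s \<in> B" "\<And>t. t \<in> B \<Longrightarrow> s \<le> t"
    using compact_attains_inf[of B] by blast
  \<comment> \<open>Membership in \<open>B\<close> only gives \<open>f s \<ge> R\<close>. The
    intermediate value theorem yields equality at some \<open>r \<le> s\<close>, and minimality of
    \<open>s\<close> forces \<open>r = s\<close>.\<close>
  have "\<exists>r. 0 \<le> r \<and> r \<le> s \<and> f r = R"
    using s(1) assms by (intro IVT') (auto simp: B_def intro: continuous_on_subset)
  then obtain r where r: "0 \<le> r" "r \<le> s" "f r = R" by blast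
  then have "r \<in> B" using s(1) by (auto simp: B_def)
  then have "r = s" using s(2)[of r] r by simp
  show ?thesis
  proof
    show "s \<in> {0..b}" using s(1) by (simp add: B_def)
    show "f s = R" using r \<open>r = s\<close> by simp
    show "f t \<le> R" if "t \<in> {0..s}" for t
    proof (rule ccontr)
      assume "\<not> f t \<le> R"
      then have "t \<in> B" using that s(1) by (auto simp: B_def)
      then have "t = s" using s(2)[of t] that by simp
      then show False using \<open>\<not> f t \<le> R\<close> r \<open>r = s\<close> by simp
    qed
  qed
qed

lemma integral_has_vector_derivative_halfline:
  fixes f :: "real \<Rightarrow> 'a::banach"
  assumes "continuous_on {a..} f" "a \<le> t"
  shows "((\<lambda>s. integral {a..s} f) has_vector_derivative f t) (at t within {a..})"
proof -
  \<comment> \<open>The interval extends beyond \<open>t\<close>, so that near \<open>t\<close> it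
    coincides with the half-line.\<close>
  have "((\<lambda>s. integral {a..s} f) has_vector_derivative f t) (at t within {a..t + 1})"
    using assms by (intro integral_has_vector_derivative) (auto intro: continuous_on_subset)
  moreover have "at t within {a..t + 1} = at t within {a..}"
    by (rule at_within_nhd[of t "{..<t + 1}"]) auto
  ultimately show ?thesis by simp
qed

text \<open>The gain \<open>1 / k\<close> against the exponential weight is what turns Picard
  iteration into a contraction on the whole half-line.\<close>

lemma norm_integral_exp_bound:
  fixes f :: "real \<Rightarrow> 'a::banach"
  assumes "continuous_on {0..s} f" "k > 0" "C \<ge> 0" "0 \<le> s"
    and le: "\<And>r. r \<in> {0..s} \<Longrightarrow> norm (f r) \<le> C * exp (k * r)"
  shows "norm (integral {0..s} f) \<le> C / k * exp (k * s)"
proof -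
  have I: "((\<lambda>r. C * exp (k * r)) has_integral (C / k * exp (k * s) - C / k * exp (k * 0))) {0..s}"
    using assms by (intro fundamental_theorem_of_calculus)
      (auto intro!: derivative_eq_intros simp flip: has_real_derivative_iff_has_vector_derivative)
  have "norm (integral {0..s} f) \<le> integral {0..s} (\<lambda>r. C * exp (k * r))"
    using assms I
    by (intro integral_norm_bound_integral integrable_continuous_real) (auto intro!: continuous_intros)
  also have "\<dots> \<le> C / k * exp (k * s)"
    using integral_unique[OF I] assms by simp
  finally show ?thesis .
qed

text \<open>\<open>P\<close> is the radial retraction onto the closed ball. The Lipschitz constant 2
  follows from the triangle inequality alone.\<close>

lemma radial_truncation:
  fixes R :: real
  assumes "R > 0"
  obtains P :: "'a::real_normed_vector \<Rightarrow> 'a"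
  where "\<And>x. norm (P x) \<le> R" "\<And>x. norm x \<le> R \<Longrightarrow> P x = x"
    "\<And>x y. norm (P x - P y) \<le> 2 * norm (x - y)"
proof
  define m where "m = (\<lambda>x::'a. max R (norm x))"
  have m: "m x \<ge> R" "m x \<ge> norm x" "m x > 0" for x
    using assms by (auto simp: m_def)
  let ?P = "\<lambda>x. (R / m x) *\<^sub>R x"
  show "norm (?P x) \<le> R" for x
    using m[of x] assms by (simp add: field_simps)
  show "?P x = x" if "norm x \<le> R" for x
    using that assms by (simp add: m_def)
  show "norm (?P x - ?P y) \<le> 2 * norm (x - y)" for x y
  proof -
    \<comment> \<open>Moves the point with the factor fixed, then the factor with the point fixed;
      each change costs at most one \<open>norm (x - y)\<close>.\<close>
    have "?P x - ?P y = (R / m x) *\<^sub>R (x - y) + (R * (m y - m x) / (m x * m y)) *\<^sub>R y"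
    proof -
      have "R * (m y - m x) / (m x * m y) = R / m x - R / m y"
        using m(3)[of x] m(3)[of y] by (simp add: field_simps)
      then show ?thesis by (simp add: scaleR_diff_right scaleR_diff_left)
    qed
    then have "norm (?P x - ?P y) \<le> norm ((R / m x) *\<^sub>R (x - y))
        + norm ((R * (m y - m x) / (m x * m y)) *\<^sub>R y)"
      by (metis norm_triangle_ineq)
    also have "norm ((R / m x) *\<^sub>R (x - y)) \<le> norm (x - y)"
      using m[of x] assms mult_right_mono[of "R / m x" 1 "norm (x - y)"]
      by (simp del: scaleR_diff_right)
    also have "norm ((R * (m y - m x) / (m x * m y)) *\<^sub>R y) \<le> norm (x - y)"
    proof -
      have "norm ((R * (m y - m x) / (m x * m y)) *\<^sub>R y) = (R / m x) * (norm y / m y) * \<bar>m y - m x\<bar>"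
        using m(3)[of x] m(3)[of y] assms by (simp add: abs_mult)
      also have "\<dots> \<le> 1 * 1 * norm (x - y)"
      proof (intro mult_mono)
        show "\<bar>m y - m x\<bar> \<le> norm (x - y)"
          using norm_triangle_ineq3[of x y] by (auto simp: m_def)
      qed (use m[of x] m[of y] assms in auto)
      finally show ?thesis by simp
    qed
    finally show ?thesis by simp
  qed
qed

lemma global_lipschitz_ode_exists:
  fixes F :: "real \<Rightarrow> 'b::banach \<Rightarrow> 'b"
  assumes cont: "continuous_on ({0..} \<times> UNIV) (\<lambda>(t, z). F t z)"
    and lip: "\<And>t x y. 0 \<le> t \<Longrightarrow> norm (F t x - F t y) \<le> L * norm (x - y)"
    and bnd: "\<And>t. 0 \<le> t \<Longrightarrow> norm (F t 0) \<le> B"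
    and "L > 0"
  obtains z where "z 0 = z0"
    "\<And>t. 0 \<le> t \<Longrightarrow> (z has_vector_derivative F t (z t)) (at t within {0..})"
proof -
  \<comment> \<open>Picard iteration for \<open>exp (- k t) z(t)\<close> is a contraction of the bounded continuous functions;
    negative times are clamped to \<open>0\<close>.\<close>
  define k where "k = 2 * L"
  have k: "k > 0" using \<open>L > 0\<close> by (simp add: k_def)
  have "B \<ge> 0" using bnd[of 0] norm_ge_zero[of "F 0 0"] by linarith
  define f where "f = (\<lambda>w s. F s (exp (k * s) *\<^sub>R apply_bcontfun w s))"
  define Q where "Q = (\<lambda>w t. z0 + integral {0..t} (f w))"
  define \<Psi> where "\<Psi> = (\<lambda>w t. exp (- k * max 0 t) *\<^sub>R Q w (max 0 t))"
  have f_cont: "continuous_on {0..} (f w)" for w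
  proof -
    have "continuous_on {0..} (\<lambda>s. (\<lambda>(t, z). F t z) (s, exp (k * s) *\<^sub>R apply_bcontfun w s))"
      by (rule continuous_on_compose2[OF cont]) (auto intro!: continuous_intros)
    then show ?thesis by (simp add: f_def)
  qed
  have Q_deriv: "(Q w has_vector_derivative f w t) (at t within {0..})" if "0 \<le> t" for w t
    unfolding Q_def
    by (auto intro!: derivative_eq_intros integral_has_vector_derivative_halfline[OF f_cont that])
  have Q_cont: "continuous_on {0..} (Q w)" for w
    using Q_deriv has_vector_derivative_continuous by (fastforce simp: continuous_on_eq_continuous_within)
  have \<Psi>_cont: "continuous_on UNIV (\<Psi> w)" for w
    unfolding \<Psi>_def
    by (intro continuous_intros continuous_on_compose2[OF Q_cont]) auto
  have f_bound: "norm (f w r) \<le> (B + L * norm w) * exp (k * r)" if "0 \<le> r" for w r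
  proof -
    have "norm (f w r) \<le> norm (F r 0) + norm (f w r - F r 0)"
      by (metis add.commute diff_add_cancel norm_triangle_ineq)
    also have "norm (f w r - F r 0) \<le> L * (exp (k * r) * norm w)"
    proof -
      have "norm (f w r - F r 0) \<le> L * norm (exp (k * r) *\<^sub>R apply_bcontfun w r)"
        using lip[OF that, of "exp (k * r) *\<^sub>R apply_bcontfun w r" 0] by (simp add: f_def)
      also have "\<dots> \<le> L * (exp (k * r) * norm w)"
        using \<open>L > 0\<close> norm_bounded[of w r] by (simp add: mult_left_mono)
      finally show ?thesis .
    qed
    also have "norm (F r 0) \<le> B * exp (k * r)"
      using bnd[OF that] \<open>B \<ge> 0\<close> k that mult_left_mono[of 1 "exp (k * r)" B] by simp
    finally show ?thesis by (simp add: algebra_simps)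
  qed
  have \<Psi>_bcont: "\<Psi> w \<in> bcontfun" for w
  proof (rule bcontfun_normI[OF \<Psi>_cont])
    fix t :: real
    let ?s = "max 0 t"
    have "continuous_on {0..?s} (f w)" by (rule continuous_on_subset[OF f_cont]) auto
    then have "norm (integral {0..?s} (f w)) \<le> (B + L * norm w) / k * exp (k * ?s)"
      by (rule norm_integral_exp_bound)
        (use f_bound k \<open>L > 0\<close> \<open>B \<ge> 0\<close> in auto)
    then have "norm (Q w ?s) \<le> norm z0 * 1 + (B + L * norm w) / k * exp (k * ?s)"
      unfolding Q_def by (metis add_left_mono mult.right_neutral norm_triangle_le)
    also have "\<dots> \<le> norm z0 * exp (k * ?s) + (B + L * norm w) / k * exp (k * ?s)"
      using k by (intro add_right_mono mult_left_mono) auto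
    finally show "norm (\<Psi> w t) \<le> norm z0 + (B + L * norm w) / k"
      by (simp add: \<Psi>_def exp_minus field_simps)
  qed
  have apply_\<Psi>: "apply_bcontfun (Bcontfun (\<Psi> w)) = \<Psi> w" for w
    using \<Psi>_bcont by (simp add: Bcontfun_inverse)
  have contraction: "dist (Bcontfun (\<Psi> v)) (Bcontfun (\<Psi> w)) \<le> 1 / 2 * dist v w" for v w
  proof (rule dist_bound)
    fix t :: real
    let ?s = "max 0 t"
    have fs: "continuous_on {0..?s} (f w)" for w
      by (rule continuous_on_subset[OF f_cont]) auto
    then have int: "f w integrable_on {0..?s}" for w
      by (rule integrable_continuous_real)
    \<comment> \<open>Since \<open>k = 2 * L\<close>, the factor \<open>L / k\<close> is the
      contraction constant 1/2.\<close>
    have "norm (integral {0..?s} (\<lambda>r. f v r - f w r)) \<le> L * dist v w / k * exp (k * ?s)"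
    proof (rule norm_integral_exp_bound)
      fix r assume r: "r \<in> {0..?s}"
      then have "norm (f v r - f w r) \<le>
          L * norm (exp (k * r) *\<^sub>R (apply_bcontfun v r - apply_bcontfun w r))"
        using lip[of r] unfolding f_def scaleR_diff_right by auto
      also have "\<dots> \<le> L * (exp (k * r) * dist v w)"
        using \<open>L > 0\<close> dist_bounded[of v r w] by (simp add: mult_left_mono dist_norm)
      finally show "norm (f v r - f w r) \<le> L * dist v w * exp (k * r)"
        by (simp add: mult_ac)
    qed (use fs k \<open>L > 0\<close> in \<open>auto intro!: continuous_intros\<close>)
    then have "norm (Q v ?s - Q w ?s) \<le> 1 / 2 * dist v w * exp (k * ?s)"
      using \<open>L > 0\<close> by (simp add: Q_def k_def integral_diff[OF int int])
    moreover have "exp (k * ?s) * norm (\<Psi> v t - \<Psi> w t) = norm (Q v ?s - Q w ?s)"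
      by (simp add: \<Psi>_def exp_minus flip: scaleR_diff_right)
    ultimately have "exp (k * ?s) * norm (\<Psi> v t - \<Psi> w t) \<le> exp (k * ?s) * (1 / 2 * dist v w)"
      by (simp add: mult_ac)
    then have "norm (\<Psi> v t - \<Psi> w t) \<le> 1 / 2 * dist v w"
      by (rule mult_left_le_imp_le) simp
    then show "dist (apply_bcontfun (Bcontfun (\<Psi> v)) t) (apply_bcontfun (Bcontfun (\<Psi> w)) t)
        \<le> 1 / 2 * dist v w"
      unfolding apply_\<Psi> dist_norm .
  qed
  have "\<exists>!w. Bcontfun (\<Psi> w) = w"
    by (rule banach_fix_type[of "1/2"]) (use contraction in auto)
  then obtain w where w: "\<Psi> w = apply_bcontfun w"
    using apply_\<Psi> by metis
  \<comment> \<open>Undoing the weight, the fixed point equation says that \<open>Q w\<close> is its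
    own Picard iterate.\<close>
  have Q_eq: "exp (k * t) *\<^sub>R apply_bcontfun w t = Q w t" if "0 \<le> t" for t
    using that unfolding w[symmetric] by (simp add: \<Psi>_def flip: exp_add)
  show ?thesis
  proof
    show "Q w 0 = z0" by (simp add: Q_def)
    show "(Q w has_vector_derivative F t (Q w t)) (at t within {0..})" if "0 \<le> t" for t
      using Q_deriv[OF that, of w] Q_eq[OF that] by (simp add: f_def)
  qed
qed

lemma has_vector_derivative_fst_snd:
  assumes "(z has_vector_derivative z') F"
  shows "((\<lambda>t. fst (z t)) has_vector_derivative fst z') F"
    and "((\<lambda>t. snd (z t)) has_vector_derivative snd z') F"
  using bounded_linear.has_vector_derivative[OF bounded_linear_fst assms]
    bounded_linear.has_vector_derivative[OF bounded_linear_snd assms] by auto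

lemma has_real_derivative_inner:
  fixes f g :: "real \<Rightarrow> 'a::real_inner"
  assumes "(f has_vector_derivative f') (at t within X)" "(g has_vector_derivative g') (at t within X)"
  shows "((\<lambda>s. f s \<bullet> g s) has_real_derivative f t \<bullet> g' + f' \<bullet> g t) (at t within X)"
proof -
  have "(\<lambda>h. f t \<bullet> (h *\<^sub>R g') + (h *\<^sub>R f') \<bullet> g t) = (*) (f t \<bullet> g' + f' \<bullet> g t)"
    by (simp add: fun_eq_iff algebra_simps)
  then show ?thesis
    using has_derivative_inner[OF assms[unfolded has_vector_derivative_def]]
    by (simp add: has_field_derivative_def)
qed

subsection \<open>The Lyapunov function\<close>

locale damped_inclusion =
  fixes \<phi> :: "'a::{real_inner, banach} \<Rightarrow> real"
    and g\<phi> g\<Theta> A :: "'a \<Rightarrow> 'a" and \<epsilon> :: "real \<Rightarrow> real"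
    and \<gamma> lam \<delta> \<eta> :: real
  assumes \<gamma>: "\<gamma> > 0"
    and \<phi>_convex: "convex_on UNIV \<phi>"
    and \<phi>_grad: "\<And>x. GDERIV \<phi> x :> g\<phi> x"
    and g\<phi>_lip: "\<And>B. bounded B \<Longrightarrow> \<exists>L. L-lipschitz_on B g\<phi>"
    and A_coco: "cocoercive lam A"
    and \<epsilon>_pos: "\<And>t. t \<ge> 0 \<Longrightarrow> \<epsilon> t > 0"
    and \<epsilon>_cont: "continuous_on {0..} \<epsilon>"
    and \<epsilon>_lim: "(\<epsilon> \<longlongrightarrow> 0) at_top"
    and \<delta>: "\<delta> > 0"
    and \<eta>: "\<eta> > 0"
    and g\<Theta>_lip: "\<And>u v. norm (g\<Theta> u - g\<Theta> v) \<le> \<delta> * norm (u - v)"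
    and g\<Theta>_strong: "\<And>u v. (g\<Theta> u - g\<Theta> v) \<bullet> (u - v) \<ge> \<eta> * (norm (u - v))\<^sup>2"
    and lam_\<gamma>: "lam * \<gamma>\<^sup>2 > 1"
begin

lemma lam: "lam > 0"
  using A_coco by (simp add: cocoercive_def)

lemma A_cocoercive: "(A v - A w) \<bullet> (v - w) \<ge> lam * (norm (A v - A w))\<^sup>2"
  using A_coco by (simp add: cocoercive_def)

lemma A_lip: "norm (A v - A w) \<le> 1 / lam * norm (v - w)"
proof (cases "A v = A w")
  case False
  have "lam * (norm (A v - A w))\<^sup>2 \<le> norm (A v - A w) * norm (v - w)"
    using A_cocoercive[of v w] norm_cauchy_schwarz[of "A v - A w" "v - w"] by linarith
  then have "lam * norm (A v - A w) \<le> norm (v - w)"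
    using False by (simp add: power2_eq_square mult.left_commute)
  then show ?thesis using lam by (simp add: field_simps)
qed (use lam in auto)

lemma A_mono: "(A v - A w) \<bullet> (v - w) \<ge> 0"
  using A_cocoercive[of v w] lam by (meson mult_nonneg_nonneg less_imp_le order_trans zero_le_power2)

lemma \<phi>_above_tangent: "\<phi> x + g\<phi> x \<bullet> (y - x) \<le> \<phi> y"
  by (rule convex_on_gderiv_above_tangent[OF \<phi>_convex \<phi>_grad])

lemma A_cont: "continuous_on X A"
  by (rule lipschitz_on_continuous_on[of "1 / lam"], rule lipschitz_onI)
    (use A_lip lam in \<open>auto simp: dist_norm\<close>)

lemma g\<Theta>_cont: "continuous_on X g\<Theta>"
  by (rule lipschitz_on_continuous_on[of "\<delta>"], rule lipschitz_onI)
    (use g\<Theta>_lip \<delta> in \<open>auto simp: dist_norm\<close>)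

lemma g\<phi>_cont: "continuous_on X g\<phi>"
proof -
  have "isCont g\<phi> x" for x
  proof -
    obtain L where "L-lipschitz_on (ball x 1) g\<phi>"
      using g\<phi>_lip[of "ball x 1"] by auto
    then have "continuous_on (ball x 1) g\<phi>" by (rule lipschitz_on_continuous_on)
    then show ?thesis by (simp add: continuous_on_eq_continuous_at)
  qed
  then show ?thesis by (simp add: continuous_at_imp_continuous_on)
qed

definition T :: "'a \<Rightarrow> 'a" where "T v = A v + g\<phi> v"

lemma T_cont: "continuous_on X T"
  unfolding T_def by (intro continuous_intros A_cont g\<phi>_cont)

text \<open>For the gradient part, add the tangent inequalities at \<open>v\<close> and at
  \<open>w\<close>.\<close>

lemma T_mono: "(T v - T w) \<bullet> (v - w) \<ge> 0"
  using A_mono[of v w] \<phi>_above_tangent[of v w] \<phi>_above_tangent[of w v]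
  by (simp add: T_def algebra_simps)

text \<open>Describes the zeros by inequalities affine in \<open>v\<close>: the zero set is an
  intersection of half-spaces, and the description survives passage to the limit in
  \<open>small_residual\<close>.\<close>

lemma T_zero_iff: "T v = 0 \<longleftrightarrow> (\<forall>w. T w \<bullet> (w - v) \<ge> 0)"
proof
  assume "T v = 0"
  then show "\<forall>w. T w \<bullet> (w - v) \<ge> 0" using T_mono[of _ v] by simp
next
  assume *: "\<forall>w. T w \<bullet> (w - v) \<ge> 0"
  have "T v \<bullet> (w - v) \<ge> 0" for w
    by (rule minty_variational[of UNIV]) (use * T_cont in auto)
  from this[of "v - T v"] have "T v \<bullet> T v \<le> 0" by simp
  then show "T v = 0" by (metis inner_eq_zero_iff inner_ge_zero order_antisym)
qed

section \<open>Bregman distance, Lyapunov function and its formal derivative\<close>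

definition D :: "'a \<Rightarrow> 'a \<Rightarrow> real" where
  "D p u = \<phi> u - \<phi> p - g\<phi> p \<bullet> (u - p)"

lemma D_nonneg: "D p u \<ge> 0"
  using \<phi>_above_tangent[of p u] by (simp add: D_def)

lemma D_le: "D p u \<le> (g\<phi> u - g\<phi> p) \<bullet> (u - p)"
  using \<phi>_above_tangent[of u p] by (simp add: D_def algebra_simps)

text \<open>With \<open>x = u - p\<close>, the part besides \<open>D\<close> equals
  \<open>(|v|^2 + |v + \<gamma> x|^2) / 4\<close>. The coefficient of \<open>|x|^2\<close> is the
  one for which the \<open>x \<bullet> v\<close> terms cancel in the derivative.\<close>

definition V :: "'a \<Rightarrow> 'a \<Rightarrow> 'a \<Rightarrow> real" where
  "V p u v = D p u + (norm v)\<^sup>2 / 2 + \<gamma> / 2 * ((u - p) \<bullet> v) + (\<gamma> / 2 * norm (u - p))\<^sup>2"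

definition \<alpha> :: real where "\<alpha> = (lam * \<gamma>\<^sup>2 - 1) / (2 * \<gamma> * (1 + lam))"

lemma \<alpha>_pos: "\<alpha> > 0"
  using lam lam_\<gamma> \<gamma> by (simp add: \<alpha>_def)

text \<open>The constant \<open>\<alpha>\<close> makes \<open>4 (\<gamma>/2 - \<alpha>) (\<gamma> lam/2 - \<alpha>) = 1 + 4 \<alpha>\<^sup>2\<close>.\<close>

lemma dissipation:
  "\<gamma> / 2 * (norm v)\<^sup>2 + a \<bullet> v + \<gamma> / 2 * lam * (norm a)\<^sup>2 \<ge> \<alpha> * ((norm v)\<^sup>2 + (norm a)\<^sup>2)"
proof -
  define r s where "r = \<gamma> / 2 - \<alpha>" and "s = \<gamma> / 2 * lam - \<alpha>"
  have e: "\<alpha> * (2 * \<gamma> * (1 + lam)) = lam * \<gamma>\<^sup>2 - 1"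
    using lam \<gamma> by (simp add: \<alpha>_def)
  \<comment> \<open>Amounts to \<open>\<alpha> < \<gamma> / 2\<close>, so that the coefficient
    \<open>r\<close> is positive.\<close>
  have "\<alpha> * (2 * \<gamma> * (1 + lam)) < \<gamma> / 2 * (2 * \<gamma> * (1 + lam))"
    using mult_pos_pos[OF \<gamma> \<gamma>] e by (simp add: power2_eq_square algebra_simps)
  then have r: "r > 0"
    unfolding r_def using lam \<gamma> mult_right_less_imp_less[of \<alpha> _ "\<gamma> / 2"] by fastforce
  have "4 * r * s = lam * \<gamma>\<^sup>2 - \<alpha> * (2 * \<gamma> * (1 + lam)) + 4 * \<alpha>\<^sup>2"
    by (simp add: r_def s_def power2_eq_square field_simps)
  then have rs: "4 * r * s \<ge> 1" using e by simp
  \<comment> \<open>Completes the square in \<open>v\<close>; nonnegativity of the remainder is the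
    discriminant condition \<open>rs\<close>.\<close>
  have "0 \<le> (norm ((2 * r) *\<^sub>R v + a))\<^sup>2 + (4 * r * s - 1) * (norm a)\<^sup>2"
    using rs by simp
  also have "\<dots> = 4 * r * (r * (norm v)\<^sup>2 + a \<bullet> v + s * (norm a)\<^sup>2)"
    unfolding power2_norm_eq_inner by (simp add: algebra_simps inner_commute)
  finally have "0 \<le> r * (norm v)\<^sup>2 + a \<bullet> v + s * (norm a)\<^sup>2"
    using r by (simp add: zero_le_mult_iff)
  then show ?thesis by (simp add: r_def s_def algebra_simps)
qed

text \<open>The value of \<epsilon> enters as a number \<open>e\<close>, so the estimates below are
  pointwise in \<open>(e, u, v)\<close> and make no reference to a trajectory.\<close>

definition rhs :: "real \<Rightarrow> 'a \<Rightarrow> 'a \<Rightarrow> 'a" where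
  "rhs e u v = - (\<gamma> *\<^sub>R v + g\<phi> u + A u + e *\<^sub>R g\<Theta> u)"

text \<open>The derivative of \<open>V p\<close> in the direction \<open>(v, w)\<close>; along a
  solution \<open>w\<close> is the acceleration.\<close>

definition dV :: "'a \<Rightarrow> 'a \<Rightarrow> 'a \<Rightarrow> 'a \<Rightarrow> real" where
  "dV p u v w = (g\<phi> u - g\<phi> p) \<bullet> v + v \<bullet> w + \<gamma> / 2 * ((norm v)\<^sup>2 + (u - p) \<bullet> w)
     + \<gamma>\<^sup>2 / 2 * ((u - p) \<bullet> v)"

lemma V_has_derivative:
  assumes u: "(u has_vector_derivative v t) (at t within X)"
    and v: "(v has_vector_derivative w) (at t within X)"
  shows "((\<lambda>s. V p (u s) (v s)) has_real_derivative dV p (u t) (v t) w) (at t within X)"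
proof -
  have up: "((\<lambda>s. u s - p) has_vector_derivative v t) (at t within X)"
    using u by (auto intro!: derivative_eq_intros)
  have "((\<lambda>s. \<phi> (u s) - \<phi> p - g\<phi> p \<bullet> (u s - p) + 1 / 2 * (v s \<bullet> v s)
      + \<gamma> / 2 * ((u s - p) \<bullet> v s) + (\<gamma> / 2)\<^sup>2 * ((u s - p) \<bullet> (u s - p))) has_real_derivative
      g\<phi> (u t) \<bullet> v t - 0 - (g\<phi> p \<bullet> v t + 0 \<bullet> (u t - p)) + 1 / 2 * (v t \<bullet> w + w \<bullet> v t)
      + \<gamma> / 2 * ((u t - p) \<bullet> w + v t \<bullet> v t)
      + (\<gamma> / 2)\<^sup>2 * ((u t - p) \<bullet> v t + v t \<bullet> (u t - p))) (at t within X)"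
    by (intro DERIV_add DERIV_diff DERIV_cmult DERIV_const GDERIV_chain_vector[OF \<phi>_grad u]
        has_real_derivative_inner[OF up up] has_real_derivative_inner[OF up v] has_real_derivative_inner[OF v v] has_real_derivative_inner[OF has_vector_derivative_const up])
  then show ?thesis
    unfolding V_def D_def dV_def power_mult_distrib power2_norm_eq_inner
    by (simp add: algebra_simps inner_commute power2_eq_square)
qed

text \<open>Inserting the equation leaves \<open>a \<bullet> x\<close>, \<open>f \<bullet> x\<close>
  and \<open>\<theta> \<bullet> x\<close>, bounded below by cocoercivity, convexity and strong
  monotonicity. The lemma \<open>dissipation\<close> absorbs the cross term
  \<open>a \<bullet> v\<close> and yields \<open>\<alpha> |v|^2\<close>, half of which pays for the
  term \<open>e * (\<theta> \<bullet> v)\<close>.\<close>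

lemma dV_le:
  assumes p: "T p = 0" and e: "e \<ge> 0"
  shows "dV p u v (rhs e u v) \<le>
    - (\<alpha> / 2) * (norm v)\<^sup>2 - \<alpha> * (norm (A u - A p))\<^sup>2 - \<gamma> / 2 * D p u
    - \<gamma> / 2 * \<eta> * e * (norm (u - p))\<^sup>2 - \<gamma> / 2 * e * (g\<Theta> p \<bullet> (u - p))
    + e\<^sup>2 / \<alpha> * ((norm (g\<Theta> p))\<^sup>2 + \<delta>\<^sup>2 * (norm (u - p))\<^sup>2)"
proof -
  define x a f \<theta> where "x = u - p" and "a = A u - A p" and "f = g\<phi> u - g\<phi> p" and "\<theta> = g\<Theta> u"
  have gp: "g\<phi> p = - A p" using p by (simp add: T_def eq_neg_iff_add_eq_0 add.commute)
  have w: "rhs e u v = - (\<gamma> *\<^sub>R v + f + a + e *\<^sub>R \<theta>)"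
    by (simp add: rhs_def a_def f_def \<theta>_def gp)
  \<comment> \<open>The terms \<open>f \<bullet> v\<close> and \<open>x \<bullet> v\<close>
    cancel.\<close>
  have "dV p u v (rhs e u v) = - (\<gamma> / 2 * (norm v)\<^sup>2 + a \<bullet> v) - \<gamma> / 2 * (a \<bullet> x) - \<gamma> / 2 * (f \<bullet> x)
      - e * (\<theta> \<bullet> v) - \<gamma> / 2 * e * (\<theta> \<bullet> x)"
    unfolding dV_def w x_def[symmetric] f_def[symmetric] power2_norm_eq_inner
    by (simp add: algebra_simps inner_commute power2_eq_square)
  moreover have "\<gamma> / 2 * (a \<bullet> x) \<ge> \<gamma> / 2 * lam * (norm a)\<^sup>2"
    using A_cocoercive[of u p] \<gamma> by (simp add: a_def x_def)
  moreover have "\<gamma> / 2 * (f \<bullet> x) \<ge> \<gamma> / 2 * D p u"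
    using D_le[of p u] \<gamma> by (simp add: f_def x_def)
  moreover have "\<gamma> / 2 * e * (\<theta> \<bullet> x) \<ge> \<gamma> / 2 * e * (g\<Theta> p \<bullet> x + \<eta> * (norm x)\<^sup>2)"
    using g\<Theta>_strong[of u p] \<gamma> e
    by (intro mult_left_mono) (auto simp: \<theta>_def x_def inner_diff_left)
  \<comment> \<open>Young's inequality with weight \<alpha>, read off from the square of
    \<open>\<alpha> v + e \<theta>\<close>.\<close>
  moreover have "- e * (\<theta> \<bullet> v) \<le> \<alpha> / 2 * (norm v)\<^sup>2 + e\<^sup>2 / (2 * \<alpha>) * (norm \<theta>)\<^sup>2"
  proof -
    have "0 \<le> (norm (\<alpha> *\<^sub>R v + e *\<^sub>R \<theta>))\<^sup>2 / (2 * \<alpha>)"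
      using \<alpha>_pos by simp
    also have "\<dots> = \<alpha> / 2 * (norm v)\<^sup>2 + e * (\<theta> \<bullet> v) + e\<^sup>2 / (2 * \<alpha>) * (norm \<theta>)\<^sup>2"
    proof -
      have "(norm (\<alpha> *\<^sub>R v + e *\<^sub>R \<theta>))\<^sup>2
          = \<alpha>\<^sup>2 * (norm v)\<^sup>2 + 2 * \<alpha> * e * (\<theta> \<bullet> v) + e\<^sup>2 * (norm \<theta>)\<^sup>2"
        unfolding power2_norm_eq_inner by (simp add: algebra_simps inner_commute power2_eq_square)
      then show ?thesis using \<alpha>_pos by (simp add: field_simps power2_eq_square)
    qed
    finally show ?thesis by simp
  qed
  moreover have "e\<^sup>2 / (2 * \<alpha>) * (norm \<theta>)\<^sup>2 \<le> e\<^sup>2 / \<alpha> * ((norm (g\<Theta> p))\<^sup>2 + \<delta>\<^sup>2 * (norm x)\<^sup>2)"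
  proof -
    have "norm \<theta> \<le> norm (g\<Theta> p) + \<delta> * norm x"
      using g\<Theta>_lip[of u p] norm_triangle_sub[of \<theta> "g\<Theta> p"] by (simp add: \<theta>_def x_def)
    then have "(norm \<theta>)\<^sup>2 \<le> (norm (g\<Theta> p) + \<delta> * norm x)\<^sup>2"
      by (intro power_mono) auto
    also have "\<dots> \<le> 2 * ((norm (g\<Theta> p))\<^sup>2 + \<delta>\<^sup>2 * (norm x)\<^sup>2)"
      using zero_le_power2[of "norm (g\<Theta> p) - \<delta> * norm x"]
      by (simp add: power2_eq_square algebra_simps)
    finally have "e\<^sup>2 / (2 * \<alpha>) * (norm \<theta>)\<^sup>2 \<le>
        e\<^sup>2 / (2 * \<alpha>) * (2 * ((norm (g\<Theta> p))\<^sup>2 + \<delta>\<^sup>2 * (norm x)\<^sup>2))"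
      using \<alpha>_pos by (intro mult_left_mono) auto
    moreover have "e\<^sup>2 / (2 * \<alpha>) * (2 * Y) = e\<^sup>2 / \<alpha> * Y" for Y by simp
    ultimately show ?thesis by (simp only:)
  qed
  ultimately show ?thesis
    using dissipation[of v a] unfolding x_def[symmetric] a_def[symmetric]
    by (simp add: algebra_simps)
qed

definition k\<^sub>V :: real where "k\<^sub>V = min (1/8) (\<gamma>\<^sup>2 / 16)"
definition K\<^sub>V :: real where "K\<^sub>V = 1 + \<gamma>\<^sup>2"

lemma V_lower: "V p u v \<ge> D p u + k\<^sub>V * ((norm v)\<^sup>2 + (norm (u - p))\<^sup>2)"
  and V_upper: "V p u v \<le> D p u + K\<^sub>V * ((norm v)\<^sup>2 + (norm (u - p))\<^sup>2)"
proof -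
  define y z where "y = norm v" and "z = \<gamma> / 2 * norm (u - p)"
  have z2: "z\<^sup>2 = \<gamma>\<^sup>2 / 4 * (norm (u - p))\<^sup>2"
    by (simp add: z_def power2_eq_square)
  have "\<bar>(u - p) \<bullet> v\<bar> \<le> norm (u - p) * norm v"
    by (rule Cauchy_Schwarz_ineq2)
  then have "\<bar>\<gamma> / 2 * ((u - p) \<bullet> v)\<bar> \<le> y * z"
    using \<gamma> by (simp add: abs_mult y_def z_def mult_ac)
  \<comment> \<open>The weights leave 1/8 of \<open>y^2\<close> and 1/3 of \<open>z^2\<close> in the
    lower bound, which is where the constants in \<open>k\<^sub>V\<close> come from.\<close>
  moreover have "2 * (y * z) \<le> 3/4 * y\<^sup>2 + 4/3 * z\<^sup>2"
    using zero_le_power2[of "3 * y - 4 * z"] by (simp add: power2_eq_square algebra_simps)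
  ultimately have b: "\<bar>\<gamma> / 2 * ((u - p) \<bullet> v)\<bar> \<le> 3/8 * y\<^sup>2 + 2/3 * z\<^sup>2" by linarith
  have V: "V p u v = D p u + y\<^sup>2 / 2 + \<gamma> / 2 * ((u - p) \<bullet> v) + z\<^sup>2"
    by (simp add: V_def y_def z_def)
  have "k\<^sub>V * y\<^sup>2 \<le> 1/8 * y\<^sup>2"
    by (intro mult_right_mono) (auto simp: k\<^sub>V_def)
  moreover have "k\<^sub>V * (norm (u - p))\<^sup>2 \<le> \<gamma>\<^sup>2 / 16 * (norm (u - p))\<^sup>2"
    by (intro mult_right_mono) (auto simp: k\<^sub>V_def)
  moreover have "z\<^sup>2 \<ge> 0" by simp
  ultimately show "V p u v \<ge> D p u + k\<^sub>V * ((norm v)\<^sup>2 + (norm (u - p))\<^sup>2)"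
    using b unfolding V y_def[symmetric] distrib_left z2 by linarith
  have "y\<^sup>2 \<ge> 0" "\<gamma>\<^sup>2 * y\<^sup>2 \<ge> 0" "(norm (u - p))\<^sup>2 \<ge> 0" "\<gamma>\<^sup>2 * (norm (u - p))\<^sup>2 \<ge> 0" by auto
  then show "V p u v \<le> D p u + K\<^sub>V * ((norm v)\<^sup>2 + (norm (u - p))\<^sup>2)"
    using b unfolding V y_def[symmetric] distrib_left z2 K\<^sub>V_def distrib_right by linarith
qed

lemma k\<^sub>V_pos: "k\<^sub>V > 0" and K\<^sub>V_pos: "K\<^sub>V > 0"
  using \<gamma> by (auto simp: k\<^sub>V_def K\<^sub>V_def add_pos_nonneg)

lemma V_nonneg: "V p u v \<ge> 0"
  using V_lower[of p u v] D_nonneg[of p u] k\<^sub>V_pos by (smt (verit) mult_nonneg_nonneg zero_le_power2)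

lemma V_coercive: "(norm (u - p))\<^sup>2 \<le> V p u v / k\<^sub>V"
proof -
  have "k\<^sub>V * (norm v)\<^sup>2 \<ge> 0" using k\<^sub>V_pos by simp
  then have "k\<^sub>V * (norm (u - p))\<^sup>2 \<le> V p u v"
    using V_lower[of p u v] D_nonneg[of p u] unfolding distrib_left by linarith
  then show ?thesis using k\<^sub>V_pos by (simp add: field_simps)
qed

section \<open>Size and primitive of the coefficient \<epsilon>\<close>

lemma \<epsilon>_bounded: obtains e where "e > 0" "\<And>t. t \<ge> 0 \<Longrightarrow> \<epsilon> t \<le> e"
proof -
  have "\<forall>\<^sub>F t in at_top. \<epsilon> t < 1"
    using \<epsilon>_lim by (rule order_tendstoD) simp
  then obtain N where N: "\<And>t. t \<ge> N \<Longrightarrow> \<epsilon> t < 1"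
    by (auto simp: eventually_at_top_linorder)
  have "compact (\<epsilon> ` {0..N})"
    by (rule compact_continuous_image[OF continuous_on_subset[OF \<epsilon>_cont]]) auto
  then have "bdd_above (\<epsilon> ` {0..N})"
    by (intro bounded_imp_bdd_above compact_imp_bounded)
  then obtain b where "\<forall>y\<in>\<epsilon> ` {0..N}. y \<le> b"
    unfolding bdd_above_def ..
  then have b: "\<epsilon> t \<le> b" if "t \<in> {0..N}" for t
    using that by blast
  show ?thesis
  proof
    show "max 1 b > 0" by simp
    show "\<epsilon> t \<le> max 1 b" if "t \<ge> 0" for t
    proof (cases "t \<le> N")
      case True
      then have "\<epsilon> t \<le> b" using b[of t] that by simp
      then show ?thesis by simp
    next
      case False
      then have "\<epsilon> t < 1" using N[of t] by simp
      then show ?thesis by simp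
    qed
  qed
qed

text \<open>The slow time in which \<open>V\<close> decays at a constant rate; divergence of the
  integral of \<epsilon> makes it run to infinity.\<close>

definition E :: "real \<Rightarrow> real" where "E t = integral {0..t} \<epsilon>"

lemma E_has_derivative:
  assumes "t \<ge> 0" "X \<subseteq> {0..}"
  shows "(E has_real_derivative \<epsilon> t) (at t within X)"
proof -
  have "(E has_vector_derivative \<epsilon> t) (at t within {0..})"
    unfolding E_def by (rule integral_has_vector_derivative_halfline[OF \<epsilon>_cont assms(1)])
  then show ?thesis
    using assms(2) has_vector_derivative_within_subset
    by (auto simp: has_real_derivative_iff_has_vector_derivative)
qed

lemma E_mono:
  assumes "0 \<le> a" "a \<le> b"
  shows "E a \<le> E b"
proof -
  have "\<epsilon> integrable_on {0..c}" for c
    by (intro integrable_continuous_real continuous_on_subset[OF \<epsilon>_cont]) auto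
  moreover have "\<epsilon> t \<ge> 0" if "t \<in> {0..b}" for t
    using \<epsilon>_pos[of t] that by simp
  ultimately show ?thesis
    unfolding E_def using assms by (intro integral_subset_le) auto
qed

text \<open>A rate for which the dissipation in \<open>dV_le\<close> covers
  \<open>\<kappa> * e * V\<close>: the first entry serves the \<open>D\<close> part of
  \<open>V_upper\<close>, the second the quadratic part.\<close>

definition \<kappa> :: real where "\<kappa> = min (\<gamma> / 4) (min (\<alpha> / 2) (\<gamma> * \<eta> / 8) / K\<^sub>V)"

lemma \<kappa>_pos: "\<kappa> > 0"
  using \<gamma> \<eta> \<alpha>_pos K\<^sub>V_pos by (simp add: \<kappa>_def)

text \<open>The last condition lets half of the strong monotonicity term absorb the error
  \<open>e^2 |x|^2\<close>; \<open>e \<le> 1\<close> lets terms of order \<open>e\<close> be charged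
  to dissipation terms without the factor \<open>e\<close>.\<close>

definition small :: "real \<Rightarrow> bool" where
  "small e \<longleftrightarrow> 0 \<le> e \<and> e \<le> 1 \<and> e * \<delta>\<^sup>2 / \<alpha> \<le> \<gamma> * \<eta> / 4"

lemma eventually_\<epsilon>_less: "c > 0 \<Longrightarrow> \<forall>\<^sub>F t in at_top. \<epsilon> t < c"
  using \<epsilon>_lim by (rule order_tendstoD)

lemma eventually_small: "\<forall>\<^sub>F t in at_top. small (\<epsilon> t)"
proof -
  have "\<gamma> * \<eta> * \<alpha> / (4 * \<delta>\<^sup>2) > 0"
    using \<gamma> \<eta> \<alpha>_pos \<delta> by simp
  from eventually_\<epsilon>_less[OF this] eventually_\<epsilon>_less[OF zero_less_one] eventually_ge_at_top[of 0]
  show ?thesis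
  proof eventually_elim
    case (elim t)
    then show ?case
      using \<epsilon>_pos[of t] \<delta> \<alpha>_pos by (simp add: small_def field_simps)
  qed
qed

text \<open>Of the coefficient \<open>\<gamma> * \<eta> / 2\<close> of \<open>e |x|^2\<close>, one
  half absorbs the quadratic error, one quarter goes into \<open>\<kappa> * e * V\<close> and one
  quarter remains. The \<open>D\<close> term is split evenly, and the \<open>|v|^2\<close> term is
  used up.\<close>

lemma dV_le_small:
  assumes p: "T p = 0" and e: "small e"
  shows "dV p u v (rhs e u v) \<le> - \<kappa> * e * V p u v - \<alpha> * (norm (A u - A p))\<^sup>2 - \<gamma> / 4 * D p u
    - \<gamma> * \<eta> / 8 * e * (norm (u - p))\<^sup>2 - \<gamma> / 2 * e * (g\<Theta> p \<bullet> (u - p))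
    + e\<^sup>2 / \<alpha> * (norm (g\<Theta> p))\<^sup>2"
proof -
  have e0: "0 \<le> e" "e \<le> 1" and ed: "e * \<delta>\<^sup>2 / \<alpha> \<le> \<gamma> * \<eta> / 4"
    using e by (auto simp: small_def)
  define y x where "y = (norm v)\<^sup>2" and "x = (norm (u - p))\<^sup>2"
  have [simp]: "y \<ge> 0" "x \<ge> 0" by (auto simp: y_def x_def)
  have 1: "e\<^sup>2 / \<alpha> * (\<delta>\<^sup>2 * x) \<le> \<gamma> * \<eta> / 4 * (e * x)"
    using mult_right_mono[OF ed, of "e * x"] e0 by (simp add: power2_eq_square mult_ac)
  have "\<kappa> * K\<^sub>V \<le> min (\<alpha> / 2) (\<gamma> * \<eta> / 8)"
    unfolding \<kappa>_def using K\<^sub>V_pos by (simp add: field_simps min_def)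
  then have K: "\<kappa> * K\<^sub>V \<le> \<alpha> / 2" "\<kappa> * K\<^sub>V \<le> \<gamma> * \<eta> / 8" by auto
  have "\<kappa> * e * V p u v \<le> \<kappa> * e * (D p u + K\<^sub>V * (y + x))"
    using V_upper[of p u v] \<kappa>_pos e0 unfolding y_def x_def by (intro mult_left_mono) auto
  also have "\<dots> = \<kappa> * (e * D p u) + (\<kappa> * K\<^sub>V) * (e * y) + (\<kappa> * K\<^sub>V) * (e * x)"
    by (simp add: algebra_simps)
  also have "\<kappa> * (e * D p u) \<le> \<gamma> / 4 * (1 * D p u)"
    using e0 D_nonneg[of p u] \<gamma> by (intro mult_mono) (auto simp: \<kappa>_def)
  also have "(\<kappa> * K\<^sub>V) * (e * y) \<le> \<alpha> / 2 * (1 * y)"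
    using e0 K \<alpha>_pos by (intro mult_mono) auto
  also have "(\<kappa> * K\<^sub>V) * (e * x) \<le> \<gamma> * \<eta> / 8 * (e * x)"
    using e0 K by (intro mult_right_mono) auto
  finally have 2: "\<kappa> * e * V p u v \<le> \<gamma> / 4 * D p u + \<alpha> / 2 * y + \<gamma> * \<eta> / 8 * (e * x)" by simp
  show ?thesis
    using dV_le[OF p e0(1), of u v] 1 2 unfolding y_def[symmetric] x_def[symmetric] distrib_left
    by (simp add: mult.assoc)
qed

text \<open>The remaining \<open>e |x|^2\<close> term pays, via Young's inequality, for the linear
  term in \<open>u - p\<close>. What is left is a source proportional to \<open>e\<close>, the form
  required by \<open>relaxation_bound\<close>.\<close>

lemma dV_le_small_bound:
  assumes p: "T p = 0" and e: "small e"
  shows "dV p u v (rhs e u v) \<le> - \<kappa> * e * V p u v + (\<gamma> / (2 * \<eta>) + 1 / \<alpha>) * (norm (g\<Theta> p))\<^sup>2 * e"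
proof -
  define x M where "x = norm (u - p)" and "M = norm (g\<Theta> p)"
  have e0: "0 \<le> e" "e \<le> 1" using e by (auto simp: small_def)
  have "- (g\<Theta> p \<bullet> (u - p)) \<le> M * x"
    using Cauchy_Schwarz_ineq2[of "g\<Theta> p" "u - p"] by (simp add: M_def x_def)
  also have "\<dots> \<le> M\<^sup>2 / \<eta> + \<eta> / 4 * x\<^sup>2"
    using \<eta> zero_le_power2[of "M - \<eta> / 2 * x"] by (simp add: field_simps power2_eq_square)
  finally have "\<gamma> / 2 * e * (- (g\<Theta> p \<bullet> (u - p))) \<le> \<gamma> / 2 * e * (M\<^sup>2 / \<eta> + \<eta> / 4 * x\<^sup>2)"
    using \<gamma> e0 by (intro mult_left_mono) auto
  moreover have "e\<^sup>2 / \<alpha> * M\<^sup>2 \<le> 1 / \<alpha> * M\<^sup>2 * e"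
  proof -
    have "e * e \<le> 1 * e" using e0 by (intro mult_right_mono) auto
    then have "e\<^sup>2 * (M\<^sup>2 / \<alpha>) \<le> e * (M\<^sup>2 / \<alpha>)"
      using \<alpha>_pos by (intro mult_right_mono) (auto simp: power2_eq_square)
    then show ?thesis by (simp add: mult_ac)
  qed
  moreover have "\<alpha> * (norm (A u - A p))\<^sup>2 \<ge> 0" "\<gamma> / 4 * D p u \<ge> 0"
    using \<alpha>_pos \<gamma> D_nonneg[of p u] by auto
  ultimately show ?thesis
    using dV_le_small[OF p e, of u v] unfolding x_def[symmetric] M_def[symmetric]
    by (simp add: algebra_simps)
qed

text \<open>A crude growth bound for the initial period in which \<epsilon> need not be small;
  Gronwall then excludes blow-up there.\<close>

lemma dV_le_linear:
  assumes p: "T p = 0" and "e0 > 0"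
  obtains C where "C \<ge> 0"
    "\<And>e u v. 0 \<le> e \<Longrightarrow> e \<le> e0 \<Longrightarrow> dV p u v (rhs e u v) \<le> C * (1 + V p u v)"
proof -
  define M where "M = (norm (g\<Theta> p))\<^sup>2"
  define a b where "a = \<gamma> / 4 * e0 * M + e0\<^sup>2 / \<alpha> * M" and "b = \<gamma> / 4 * e0 + e0\<^sup>2 / \<alpha> * \<delta>\<^sup>2"
  have ab: "a \<ge> 0" "b \<ge> 0" using \<gamma> \<alpha>_pos \<open>e0 > 0\<close> by (auto simp: a_def b_def M_def)
  show ?thesis
  proof
    show "a + b / k\<^sub>V \<ge> 0" using ab k\<^sub>V_pos by simp
    fix e :: real and u v :: 'a
    assume e: "0 \<le> e" "e \<le> e0"
    define x where "x = (norm (u - p))\<^sup>2"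
    have [simp]: "x \<ge> 0" "M \<ge> 0" by (auto simp: x_def M_def)
    have "- (g\<Theta> p \<bullet> (u - p)) \<le> norm (g\<Theta> p) * norm (u - p)"
      using Cauchy_Schwarz_ineq2[of "g\<Theta> p" "u - p"] by simp
    also have "\<dots> \<le> 1 / 2 * (M + x)"
      using zero_le_power2[of "norm (g\<Theta> p) - norm (u - p)"]
      by (simp add: M_def x_def power2_eq_square algebra_simps)
    finally have "\<gamma> / 2 * e * (- (g\<Theta> p \<bullet> (u - p))) \<le> \<gamma> / 2 * e * (1 / 2 * (M + x))"
      using \<gamma> e by (intro mult_left_mono) auto
    also have "\<dots> \<le> \<gamma> / 2 * e0 * (1 / 2 * (M + x))"
      using \<gamma> e by (intro mult_right_mono mult_left_mono) auto
    finally have "\<gamma> / 2 * e * (- (g\<Theta> p \<bullet> (u - p))) \<le> \<gamma> / 2 * e0 * (1 / 2 * (M + x))" .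
    moreover have "e\<^sup>2 / \<alpha> * (M + \<delta>\<^sup>2 * x) \<le> e0\<^sup>2 / \<alpha> * (M + \<delta>\<^sup>2 * x)"
      using e \<alpha>_pos by (intro mult_right_mono divide_right_mono power_mono) auto
    moreover have "\<alpha> / 2 * (norm v)\<^sup>2 \<ge> 0" "\<alpha> * (norm (A u - A p))\<^sup>2 \<ge> 0" "\<gamma> / 2 * D p u \<ge> 0"
      "\<gamma> / 2 * \<eta> * e * x \<ge> 0"
      using \<alpha>_pos \<gamma> \<eta> e D_nonneg[of p u] by auto
    ultimately have "dV p u v (rhs e u v) \<le> a + b * x"
      using dV_le[OF p e(1), of u v] unfolding x_def[symmetric] M_def[symmetric] a_def b_def
      by (simp add: algebra_simps add_divide_distrib)
    also have "\<dots> \<le> a + b * (V p u v / k\<^sub>V)"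
      using ab V_coercive[of u p v] unfolding x_def by (intro add_left_mono mult_left_mono)
    also have "\<dots> \<le> (a + b / k\<^sub>V) * (1 + V p u v)"
      using ab k\<^sub>V_pos V_nonneg[of p u v] by (simp add: algebra_simps)
    finally show "dV p u v (rhs e u v) \<le> (a + b / k\<^sub>V) * (1 + V p u v)" .
  qed
qed

section \<open>A priori bound along solutions of the first-order system\<close>

definition solves_on :: "real set \<Rightarrow> (real \<Rightarrow> 'a) \<Rightarrow> (real \<Rightarrow> 'a) \<Rightarrow> bool" where
  "solves_on X u v \<longleftrightarrow> (\<forall>t\<in>X. (u has_vector_derivative v t) (at t within X) \<and>
     (v has_vector_derivative rhs (\<epsilon> t) (u t) (v t)) (at t within X))"

lemma solves_on_subset: "solves_on X u v \<Longrightarrow> Y \<subseteq> X \<Longrightarrow> solves_on Y u v"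
  unfolding solves_on_def by (meson has_vector_derivative_within_subset subsetD)

lemma V_solves_on_derivative:
  assumes "solves_on X u v" "t \<in> X"
  shows "((\<lambda>s. V p (u s) (v s)) has_real_derivative dV p (u t) (v t) (rhs (\<epsilon> t) (u t) (v t)))
    (at t within X)"
  by (rule V_has_derivative) (use assms in \<open>auto simp: solves_on_def\<close>)

text \<open>\<open>M\<close> depends on neither the solution nor \<open>b\<close>, so a truncation
  radius can be fixed before a solution is known. Gronwall covers the times up to \<open>t1\<close>,
  relaxation in slow time the later ones.\<close>

lemma V_bounded:
  assumes p: "T p = 0"
  obtains M where "\<And>u v b. 0 \<le> b \<Longrightarrow> solves_on {0..b} u v \<Longrightarrow> V p (u 0) (v 0) \<le> V0 \<Longrightarrow>
    V p (u b) (v b) \<le> M"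
proof -
  obtain e0 where e0: "e0 > 0" "\<And>t. t \<ge> 0 \<Longrightarrow> \<epsilon> t \<le> e0" using \<epsilon>_bounded by blast
  obtain C where C: "C \<ge> 0"
    "\<And>e u v. 0 \<le> e \<Longrightarrow> e \<le> e0 \<Longrightarrow> dV p u v (rhs e u v) \<le> C * (1 + V p u v)"
    using dV_le_linear[OF p e0(1)] by blast
  obtain t0 where t0: "\<And>t. t \<ge> t0 \<Longrightarrow> small (\<epsilon> t)"
    using eventually_small by (auto simp: eventually_at_top_linorder)
  define t1 where "t1 = max 0 t0"
  define C' where "C' = (\<gamma> / (2 * \<eta>) + 1 / \<alpha>) * (norm (g\<Theta> p))\<^sup>2"
  have C': "C' / \<kappa> \<ge> 0" using \<gamma> \<eta> \<alpha>_pos \<kappa>_pos by (simp add: C'_def)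
  define W where "W = (1 + max 0 V0) * exp (C * t1)"
  have early: "V p (u b) (v b) \<le> W"
    if b: "0 \<le> b" "b \<le> t1" and sol: "solves_on {0..b} u v" and V0: "V p (u 0) (v 0) \<le> V0" for u v b
  proof -
    have "(1 + V p (u b) (v b)) * exp (- C * b) \<le> (1 + V p (u 0) (v 0)) * exp (- C * 0)"
    proof (rule integrating_factor_decreasing[OF b(1)])
      fix t assume t: "t \<in> {0..b}"
      show "((\<lambda>t. 1 + V p (u t) (v t)) has_real_derivative
          dV p (u t) (v t) (rhs (\<epsilon> t) (u t) (v t))) (at t within {0..b})"
        using V_solves_on_derivative[OF sol t] by (auto intro!: derivative_eq_intros)
      show "((\<lambda>t. - C * t) has_real_derivative - C) (at t within {0..b})"
        by (auto intro!: derivative_eq_intros)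
      show "dV p (u t) (v t) (rhs (\<epsilon> t) (u t) (v t)) \<le> - (- C) * (1 + V p (u t) (v t))"
        using C(2)[of "\<epsilon> t"] \<epsilon>_pos[of t] e0(2)[of t] t by simp
    qed
    then have "(1 + V p (u b) (v b)) \<le> (1 + V p (u 0) (v 0)) * exp (C * b)"
      by (simp add: exp_minus field_simps)
    also have "\<dots> \<le> W"
      unfolding W_def using V0 b C(1) V_nonneg[of p "u 0" "v 0"]
      by (intro mult_mono) (auto intro: mult_left_mono)
    finally show ?thesis by simp
  qed
  have "W \<ge> 0" by (simp add: W_def)
  show ?thesis
  proof
    fix u v b
    assume b: "0 \<le> b" and sol: "solves_on {0..b} u v" and V0: "V p (u 0) (v 0) \<le> V0"
    show "V p (u b) (v b) \<le> C' / \<kappa> + W"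
    proof (cases "b \<le> t1")
      case True
      then show ?thesis using early[OF b True sol V0] C' by simp
    next
      case False
      have t1: "0 \<le> t1" "t1 \<le> b" using False by (auto simp: t1_def)
      have sol1: "solves_on {t1..b} u v"
        by (rule solves_on_subset[OF sol]) (use t1 in auto)
      have "V p (u t1) (v t1) \<le> W"
        by (rule early) (use t1 V0 in \<open>auto intro: solves_on_subset[OF sol]\<close>)
      moreover have "V p (u b) (v b) \<le>
          C' / \<kappa> + (V p (u t1) (v t1) - C' / \<kappa>) * exp (- \<kappa> * (E b - E t1))"
      proof (rule relaxation_bound[OF t1(2) \<kappa>_pos])
        fix t assume t: "t \<in> {t1..b}"
        show "((\<lambda>t. V p (u t) (v t)) has_real_derivative
            dV p (u t) (v t) (rhs (\<epsilon> t) (u t) (v t))) (at t within {t1..b})"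
          by (rule V_solves_on_derivative[OF sol1 t])
        show "(E has_real_derivative \<epsilon> t) (at t within {t1..b})"
          by (rule E_has_derivative) (use t t1 in auto)
        show "dV p (u t) (v t) (rhs (\<epsilon> t) (u t) (v t)) \<le> - \<kappa> * \<epsilon> t * V p (u t) (v t) + C' * \<epsilon> t"
          unfolding C'_def by (rule dV_le_small_bound[OF p t0]) (use t in \<open>auto simp: t1_def\<close>)
      qed
      moreover have "(V p (u t1) (v t1) - C' / \<kappa>) * exp (- \<kappa> * (E b - E t1)) \<le> W"
      proof -
        have "(V p (u t1) (v t1) - C' / \<kappa>) * exp (- \<kappa> * (E b - E t1))
            \<le> W * exp (- \<kappa> * (E b - E t1))"
          using C' calculation(1) by (intro mult_right_mono) auto
        also have "\<dots> \<le> W * 1"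
          using \<open>W \<ge> 0\<close> \<kappa>_pos E_mono[OF t1] by (intro mult_left_mono) auto
        finally show ?thesis by simp
      qed
      ultimately show ?thesis by simp
    qed
  qed
qed

subsection \<open>Strong convergence\<close>

lemma zeros_halfspaces: "{v. T v = 0} = (\<Inter>w. {v. T w \<bullet> v \<le> T w \<bullet> w})"
  by (auto simp: T_zero_iff inner_diff_right)

lemma closed_zeros: "closed {v. T v = 0}"
  unfolding zeros_halfspaces by (intro closed_INT ballI closed_halfspace_le)

lemma convex_zeros: "convex {v. T v = 0}"
  unfolding zeros_halfspaces by (intro convex_INT convex_halfspace_le)

text \<open>Replaces a weak compactness argument: by monotonicity, points of small residual lie in nested
  bounded closed convex sets, and by Minty's lemma the intersection of these consists of zeros of \<open>T\<close>.\<close>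

lemma small_residual:
  assumes p: "solves_VI g\<Theta> {v. T v = 0} p" and "\<mu> > 0"
  obtains d where "d > 0"
    "\<And>u. norm (u - p) \<le> R \<Longrightarrow> norm (A u - A p) \<le> d \<Longrightarrow> D p u \<le> d \<Longrightarrow> g\<Theta> p \<bullet> (u - p) \<ge> - \<mu>"
proof (rule ccontr)
  note conclude = that
  assume "\<not> thesis"
  then have no: "\<exists>u. norm (u - p) \<le> R \<and> norm (A u - A p) \<le> d \<and> D p u \<le> d \<and> g\<Theta> p \<bullet> (u - p) < - \<mu>"
    if "d > 0" for d
    using conclude[OF \<open>d > 0\<close>] by (meson not_le)
  have Tp: "T p = 0" using p by (simp add: solves_VI_def)
  \<comment> \<open>The half-space keeps \<open>g\<Theta> p \<bullet> (u - p) \<le> - \<mu>\<close>.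
    The slack in the Minty inequalities vanishes as \<open>n\<close> grows, so a common point is a
    zero of \<open>T\<close>.\<close>
  define C where "C = (\<lambda>n. cball p R \<inter> {u. g\<Theta> p \<bullet> u \<le> g\<Theta> p \<bullet> p - \<mu>} \<inter>
    (\<Inter>w. {u. T w \<bullet> u \<le> T w \<bullet> w + (1 + norm (w - p) + R) / real (Suc n)}))"
  have R: "R \<ge> 0" using no[of 1] by (meson norm_ge_zero order_trans zero_less_one)
  have "(\<Inter>n. C n) \<noteq> {}"
  proof (rule nested_closed_convex_nonempty)
    show "decseq C"
      unfolding decseq_def C_def
    proof (intro allI impI Int_mono order_refl INT_anti_mono Collect_mono)
      fix i j :: nat and w u :: 'a
      assume "i \<le> j" "T w \<bullet> u \<le> T w \<bullet> w + (1 + norm (w - p) + R) / real (Suc j)"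
      moreover have "(1 + norm (w - p) + R) / real (Suc j) \<le> (1 + norm (w - p) + R) / real (Suc i)"
        using \<open>i \<le> j\<close> R by (intro divide_left_mono) auto
      ultimately show "T w \<bullet> u \<le> T w \<bullet> w + (1 + norm (w - p) + R) / real (Suc i)"
        by linarith
    qed
    show "closed (C n)" for n
      unfolding C_def by (intro closed_Int closed_INT ballI closed_halfspace_le closed_cball)
    show "convex (C n)" for n
      unfolding C_def by (intro convex_Int convex_INT convex_halfspace_le convex_cball)
    show "bounded (C 0)"
      by (rule bounded_subset[OF bounded_cball[of p R]]) (auto simp: C_def)
    show "C n \<noteq> {}" for n
    proof -
      define d where "d = 1 / real (Suc n)"
      have d: "d > 0" by (simp add: d_def)
      obtain u where u: "norm (u - p) \<le> R" "norm (A u - A p) \<le> d" "D p u \<le> d"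
        "g\<Theta> p \<bullet> (u - p) < - \<mu>"
        using no[OF d] by blast
      have "T w \<bullet> u \<le> T w \<bullet> w + (1 + norm (w - p) + R) / real (Suc n)" for w
      proof -
        \<comment> \<open>Monotonicity replaces \<open>A w\<close> by \<open>A u\<close>, which is
          close to \<open>A p\<close>. The gradient part below is at most
          \<open>D p u - D p w\<close>, by the tangent at \<open>w\<close>.\<close>
        have "(A w - A p) \<bullet> (u - w) \<le> (A u - A p) \<bullet> (u - w)"
          using A_mono[of u w] by (simp add: inner_diff_left)
        also have "\<dots> \<le> norm (A u - A p) * norm (u - w)"
          by (rule norm_cauchy_schwarz)
        also have "\<dots> \<le> d * (norm (w - p) + R)"
          using u norm_triangle_ineq4[of "u - p" "w - p"] d by (intro mult_mono) auto
        finally have "(A w - A p) \<bullet> (u - w) \<le> d * (norm (w - p) + R)" .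
        moreover have "(g\<phi> w - g\<phi> p) \<bullet> (u - w) \<le> d"
          using \<phi>_above_tangent[of w u] D_nonneg[of p w] u(3)
          by (simp add: D_def algebra_simps)
        moreover have "T w \<bullet> (u - w) = T p \<bullet> (u - w) + (A w - A p) \<bullet> (u - w) + (g\<phi> w - g\<phi> p) \<bullet> (u - w)"
          by (simp add: T_def algebra_simps)
        ultimately have "T w \<bullet> (u - w) \<le> d * (1 + norm (w - p) + R)"
          using Tp by (simp add: distrib_left)
        then show ?thesis by (simp add: d_def inner_diff_right)
      qed
      then have "u \<in> C n"
        using u by (simp add: C_def dist_norm norm_minus_commute inner_diff_right)
      then show ?thesis by blast
    qed
  qed
  then obtain u where u: "\<And>n. u \<in> C n" by blast
  have "T w \<bullet> (w - u) \<ge> 0" for w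
  proof -
    have "(\<lambda>n. T w \<bullet> w + (1 + norm (w - p) + R) * (1 / real (Suc n))) \<longlonglongrightarrow>
        T w \<bullet> w + (1 + norm (w - p) + R) * 0"
      by (intro tendsto_intros LIMSEQ_Suc[OF lim_1_over_n])
    moreover have "\<exists>N. \<forall>n\<ge>N. T w \<bullet> u \<le> T w \<bullet> w + (1 + norm (w - p) + R) * (1 / real (Suc n))"
      using u by (auto simp: C_def)
    ultimately have "T w \<bullet> u \<le> T w \<bullet> w + (1 + norm (w - p) + R) * 0"
      by (rule LIMSEQ_le_const)
    then show ?thesis by (simp add: inner_diff_right)
  qed
  then have "T u = 0" by (simp add: T_zero_iff)
  then have "g\<Theta> p \<bullet> (u - p) \<ge> 0" using p by (simp add: solves_VI_def)
  moreover have "g\<Theta> p \<bullet> u \<le> g\<Theta> p \<bullet> p - \<mu>" using u[of 0] by (simp add: C_def)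
  ultimately show False using \<open>\<mu> > 0\<close> by (simp add: inner_diff_right)
qed

text \<open>\<open>eventually_le\<close> is used twice: first with a large \<open>C\<close>, to
  confine the trajectory to a ball around \<open>p\<close>, then with arbitrarily small
  \<open>C\<close>, once \<open>small_residual\<close> is available on that ball.\<close>

lemma V_tendsto_zero:
  assumes p: "solves_VI g\<Theta> {v. T v = 0} p" and sol: "solves_on {0..} u v"
    and E: "filterlim E at_top at_top"
  shows "((\<lambda>t. V p (u t) (v t)) \<longlongrightarrow> 0) at_top"
proof -
  have Tp: "T p = 0" using p by (simp add: solves_VI_def)
  \<comment> \<open>The limiting level is \<open>C\<close>; the factor 2 leaves room for the
    decaying exponential.\<close>
  have eventually_le: "\<forall>\<^sub>F t in at_top. V p (u t) (v t) \<le> 2 * C"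
    if "C > 0" and ev: "\<forall>\<^sub>F t in at_top. dV p (u t) (v t) (rhs (\<epsilon> t) (u t) (v t)) \<le>
      - \<kappa> * \<epsilon> t * V p (u t) (v t) + \<kappa> * C * \<epsilon> t" for C
  proof -
    obtain a where a: "a \<ge> 0" and le: "\<And>t. t \<ge> a \<Longrightarrow> dV p (u t) (v t) (rhs (\<epsilon> t) (u t) (v t)) \<le>
        - \<kappa> * \<epsilon> t * V p (u t) (v t) + \<kappa> * C * \<epsilon> t"
      using eventually_conj[OF ev eventually_ge_at_top[of 0]]
      unfolding eventually_at_top_linorder by (meson order_refl)
    have bound: "V p (u t) (v t) \<le>
        \<kappa> * C / \<kappa> + (V p (u a) (v a) - \<kappa> * C / \<kappa>) * exp (- \<kappa> * (E t - E a))" if "t \<ge> a" for t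
    proof (rule relaxation_bound[OF that \<kappa>_pos])
      fix s assume s: "s \<in> {a..t}"
      have "solves_on {a..t} u v" by (rule solves_on_subset[OF sol]) (use a in auto)
      then show "((\<lambda>s. V p (u s) (v s)) has_real_derivative
          dV p (u s) (v s) (rhs (\<epsilon> s) (u s) (v s))) (at s within {a..t})"
        using s by (rule V_solves_on_derivative)
      show "(E has_real_derivative \<epsilon> s) (at s within {a..t})"
        by (rule E_has_derivative) (use s a in auto)
      show "dV p (u s) (v s) (rhs (\<epsilon> s) (u s) (v s)) \<le>
          - \<kappa> * \<epsilon> s * V p (u s) (v s) + \<kappa> * C * \<epsilon> s"
        using le s by simp
    qed
    have "filterlim (\<lambda>t. - E a + E t) at_top at_top"
      by (rule filterlim_tendsto_add_at_top[OF tendsto_const E])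
    then have "filterlim (\<lambda>t. \<kappa> * (E t - E a)) at_top at_top"
      using filterlim_tendsto_pos_mult_at_top[OF tendsto_const \<kappa>_pos] by simp
    then have "filterlim (\<lambda>t. - \<kappa> * (E t - E a)) at_bot at_top"
      by (simp add: filterlim_uminus_at_bot)
    then have "((\<lambda>t. exp (- \<kappa> * (E t - E a))) \<longlongrightarrow> 0) at_top"
      by (rule filterlim_compose[OF exp_at_bot])
    then have "((\<lambda>t. C + (V p (u a) (v a) - C) * exp (- \<kappa> * (E t - E a))) \<longlongrightarrow>
        C + (V p (u a) (v a) - C) * 0) at_top"
      by (intro tendsto_intros)
    then have "\<forall>\<^sub>F t in at_top. C + (V p (u a) (v a) - C) * exp (- \<kappa> * (E t - E a)) < 2 * C"
      by (rule order_tendstoD) (use \<open>C > 0\<close> in simp)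
    with eventually_ge_at_top[of a] show ?thesis
      by eventually_elim (use bound \<kappa>_pos in force)
  qed
  define M where "M = norm (g\<Theta> p)"
  have "\<exists>R. \<forall>\<^sub>F t in at_top. norm (u t - p) \<le> R"
  proof -
    \<comment> \<open>The summand 1 keeps \<open>C\<close> positive even if
      \<open>g\<Theta> p = 0\<close>.\<close>
    define C where "C = ((\<gamma> / (2 * \<eta>) + 1 / \<alpha>) * M\<^sup>2 + 1) / \<kappa>"
    have C: "\<kappa> * C = (\<gamma> / (2 * \<eta>) + 1 / \<alpha>) * M\<^sup>2 + 1" using \<kappa>_pos by (simp add: C_def)
    have "C > 0" using \<gamma> \<eta> \<alpha>_pos \<kappa>_pos by (simp add: C_def add_nonneg_pos)
    then have "\<forall>\<^sub>F t in at_top. V p (u t) (v t) \<le> 2 * C"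
    proof (rule eventually_le)
      show "\<forall>\<^sub>F t in at_top. dV p (u t) (v t) (rhs (\<epsilon> t) (u t) (v t)) \<le>
          - \<kappa> * \<epsilon> t * V p (u t) (v t) + \<kappa> * C * \<epsilon> t"
        using eventually_small
      proof eventually_elim
        case (elim t)
        then have "\<epsilon> t \<ge> 0" by (simp add: small_def)
        then show ?case
          using dV_le_small_bound[OF Tp elim, of "u t" "v t"] unfolding C M_def
          by (simp add: algebra_simps)
      qed
    qed
    then have "\<forall>\<^sub>F t in at_top. norm (u t - p) \<le> sqrt (2 * C / k\<^sub>V)"
    proof eventually_elim
      case (elim t)
      then have "V p (u t) (v t) / k\<^sub>V \<le> 2 * C / k\<^sub>V"
        using k\<^sub>V_pos by (intro divide_right_mono) auto
      then show ?case
        using V_coercive[of "u t" p "v t"] by (intro real_le_rsqrt) linarith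
    qed
    then show ?thesis by blast
  qed
  then obtain R where R: "\<forall>\<^sub>F t in at_top. norm (u t - p) \<le> R" by blast
  have "\<forall>\<^sub>F t in at_top. V p (u t) (v t) < c" if "c > 0" for c
  proof -
    define C where "C = c / 3"
    have "C > 0" using that by (simp add: C_def)
    \<comment> \<open>Chosen so that \<open>\<gamma> / 2 * e * \<mu>\<close> is half of the allowed
      source \<open>\<kappa> * C * e\<close>; through \<open>e2\<close> the other half pays for the
      term of order \<open>e^2\<close>.\<close>
    define \<mu> where "\<mu> = \<kappa> * C / \<gamma>"
    have "\<mu> > 0" using \<kappa>_pos \<gamma> \<open>C > 0\<close> by (simp add: \<mu>_def)
    obtain d where d: "d > 0" "\<And>u. norm (u - p) \<le> R \<Longrightarrow> norm (A u - A p) \<le> d \<Longrightarrow> D p u \<le> d \<Longrightarrow>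
        g\<Theta> p \<bullet> (u - p) \<ge> - \<mu>"
      using small_residual[OF p \<open>\<mu> > 0\<close>, of R] by blast
    \<comment> \<open>The least dissipation once one of the two residual bounds fails. Below
      \<open>e1\<close>, the linear term of order \<open>e\<close> does not exceed it.\<close>
    define r where "r = min (\<alpha> * d\<^sup>2) (\<gamma> / 4 * d)"
    have "r > 0" using d(1) \<alpha>_pos \<gamma> by (simp add: r_def)
    define e1 where "e1 = r / (\<gamma> / 2 * M * \<bar>R\<bar> + 1)"
    define e2 where "e2 = \<kappa> * C / 2 / (M\<^sup>2 / \<alpha> + 1)"
    have den: "\<gamma> / 2 * M * \<bar>R\<bar> + 1 > 0" "M\<^sup>2 / \<alpha> + 1 > 0"
      using \<gamma> \<alpha>_pos by (auto intro!: add_nonneg_pos simp: M_def)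
    have "e1 > 0" "e2 > 0"
      using den \<open>r > 0\<close> \<kappa>_pos \<open>C > 0\<close> by (auto simp: e1_def e2_def)
    have "\<forall>\<^sub>F t in at_top. V p (u t) (v t) \<le> 2 * C"
    proof (rule eventually_le[OF \<open>C > 0\<close>])
      show "\<forall>\<^sub>F t in at_top. dV p (u t) (v t) (rhs (\<epsilon> t) (u t) (v t)) \<le>
          - \<kappa> * \<epsilon> t * V p (u t) (v t) + \<kappa> * C * \<epsilon> t"
        using eventually_small R eventually_\<epsilon>_less[OF \<open>e1 > 0\<close>] eventually_\<epsilon>_less[OF \<open>e2 > 0\<close>]
      proof eventually_elim
        case (elim t)
        define e x where "e = \<epsilon> t" and "x = u t"
        have e: "e \<ge> 0" "e < e1" "e < e2" and xR: "norm (x - p) \<le> R"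
          using elim by (auto simp: small_def e_def x_def)
        have "e * (M\<^sup>2 / \<alpha> + 1) \<le> \<kappa> * C / 2"
          using e(3) den by (simp add: e2_def field_simps)
        then have "e * (M\<^sup>2 / \<alpha>) \<le> \<kappa> * C / 2" using e(1) by (simp add: algebra_simps)
        then have "e * (e * (M\<^sup>2 / \<alpha>)) \<le> e * (\<kappa> * C / 2)"
          using e(1) by (rule mult_left_mono)
        then have 1: "e\<^sup>2 / \<alpha> * M\<^sup>2 \<le> \<kappa> * C / 2 * e"
          by (simp add: power2_eq_square mult_ac)
        have nonneg: "\<alpha> * (norm (A x - A p))\<^sup>2 \<ge> 0" "\<gamma> / 4 * D p x \<ge> 0"
          using \<alpha>_pos \<gamma> D_nonneg[of p x] by auto
        have 2: "- \<alpha> * (norm (A x - A p))\<^sup>2 - \<gamma> / 4 * D p x - \<gamma> / 2 * e * (g\<Theta> p \<bullet> (x - p))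
            \<le> \<kappa> * C / 2 * e"
        \<comment> \<open>Small residual: the linear term is almost of the right sign. Large
          residual: the fixed dissipation \<open>r\<close> beats it.\<close>
        proof (cases "norm (A x - A p) \<le> d \<and> D p x \<le> d")
          case True
          then have "\<gamma> / 2 * e * (- \<mu>) \<le> \<gamma> / 2 * e * (g\<Theta> p \<bullet> (x - p))"
            using d(2)[OF xR] \<gamma> e(1) by (intro mult_left_mono) auto
          moreover have "\<gamma> / 2 * e * (- \<mu>) = - (\<kappa> * C / 2 * e)"
            using \<gamma> by (simp add: \<mu>_def)
          ultimately show ?thesis using nonneg by linarith
        next
          case False
          have "r \<le> \<alpha> * (norm (A x - A p))\<^sup>2 + \<gamma> / 4 * D p x"
          proof (cases "norm (A x - A p) \<le> d")
            case True
            then have "\<gamma> / 4 * d \<le> \<gamma> / 4 * D p x"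
              using False \<gamma> by (intro mult_left_mono) auto
            then show ?thesis using nonneg by (simp add: r_def)
          next
            case False
            then have "\<alpha> * d\<^sup>2 \<le> \<alpha> * (norm (A x - A p))\<^sup>2"
              using \<alpha>_pos d(1) by (intro mult_left_mono power_mono) auto
            then show ?thesis using nonneg by (simp add: r_def)
          qed
          moreover have "- (\<gamma> / 2 * e * (g\<Theta> p \<bullet> (x - p))) \<le> r"
          proof -
            have "- (g\<Theta> p \<bullet> (x - p)) \<le> M * norm (x - p)"
              using Cauchy_Schwarz_ineq2[of "g\<Theta> p" "x - p"] by (simp add: M_def)
            also have "\<dots> \<le> M * \<bar>R\<bar>"
              using xR by (intro mult_left_mono) (auto simp: M_def)
            finally have "\<gamma> / 2 * e * (- (g\<Theta> p \<bullet> (x - p))) \<le> \<gamma> / 2 * e * (M * \<bar>R\<bar>)"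
              using \<gamma> e(1) by (intro mult_left_mono) auto
            also have "\<dots> \<le> e * (\<gamma> / 2 * M * \<bar>R\<bar> + 1)"
              using e(1) by (simp add: algebra_simps)
            also have "\<dots> \<le> r"
              using e(2) den by (simp add: e1_def field_simps)
            finally show ?thesis by simp
          qed
          moreover have "\<kappa> * C / 2 * e \<ge> 0" using \<kappa>_pos \<open>C > 0\<close> e(1) by simp
          ultimately show ?thesis by linarith
        qed
        have "\<gamma> * \<eta> / 8 * e * (norm (x - p))\<^sup>2 \<ge> 0" using \<gamma> \<eta> e(1) by simp
        then show ?case
          using dV_le_small[OF Tp elim(1), of "u t" "v t"] 1 2
          unfolding e_def[symmetric] x_def[symmetric] M_def[symmetric] by (simp add: algebra_simps)
      qed
    qed
    then show ?thesis
      by eventually_elim (use that in \<open>simp add: C_def\<close>)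
  qed
  moreover have "\<forall>\<^sub>F t in at_top. c < V p (u t) (v t)" if "c < 0" for c
    using that V_nonneg by (intro always_eventually allI) (rule less_le_trans)
  ultimately show ?thesis by (intro order_tendstoI)
qed

lemma solution_tendsto:
  assumes p: "solves_VI g\<Theta> {v. T v = 0} p" and sol: "solves_on {0..} u v"
    and E: "filterlim E at_top at_top"
  shows "(u \<longlongrightarrow> p) at_top"
proof -
  have "((\<lambda>t. V p (u t) (v t) / k\<^sub>V) \<longlongrightarrow> 0 / k\<^sub>V) at_top"
    using k\<^sub>V_pos by (intro tendsto_divide V_tendsto_zero[OF p sol E] tendsto_const) auto
  then have "((\<lambda>t. sqrt (V p (u t) (v t) / k\<^sub>V)) \<longlongrightarrow> sqrt 0) at_top"
    by (intro tendsto_real_sqrt) simp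
  then have lim: "((\<lambda>t. sqrt (V p (u t) (v t) / k\<^sub>V)) \<longlongrightarrow> 0) at_top"
    by simp
  have "norm (u t - p) \<le> sqrt (V p (u t) (v t) / k\<^sub>V)" for t
    by (rule real_le_rsqrt[OF V_coercive])
  then have "((\<lambda>t. u t - p) \<longlongrightarrow> 0) at_top"
    by (rule Lim_null_comparison[OF always_eventually[OF allI] lim])
  then show ?thesis by (rule LIM_zero_cancel)
qed

subsection \<open>Existence and uniqueness\<close>

lemma solves_onI_fst_snd:
  assumes "\<And>t. t \<in> X \<Longrightarrow>
    (z has_vector_derivative (snd (z t), rhs (\<epsilon> t) (fst (z t)) (snd (z t)))) (at t within X)"
  shows "solves_on X (\<lambda>t. fst (z t)) (\<lambda>t. snd (z t))"
  using has_vector_derivative_fst_snd[OF assms] by (simp add: solves_on_def)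

lemma solution_exists:
  assumes p: "T p = 0"
  obtains u v where "u 0 = u0" "v 0 = v0" "solves_on {0..} u v"
proof -
  obtain M where M: "\<And>u v b. 0 \<le> b \<Longrightarrow> solves_on {0..b} u v \<Longrightarrow> V p (u 0) (v 0) \<le> V p u0 v0 \<Longrightarrow>
    V p (u b) (v b) \<le> M"
    using V_bounded[OF p, of "V p u0 v0"] by blast
  \<comment> \<open>Strictly exceeds both \<open>norm u0\<close> and every \<open>norm u\<close>
    permitted by \<open>V p u v \<le> M\<close>; the absolute value avoids a discussion of the sign
    of \<open>M\<close>.\<close>
  define R where "R = norm u0 + norm p + sqrt \<bar>M / k\<^sub>V\<bar> + 1"
  have R: "R > 0" by (simp add: R_def add_nonneg_pos)
  obtain P :: "'a \<Rightarrow> 'a" where P: "\<And>x. norm (P x) \<le> R" "\<And>x. norm x \<le> R \<Longrightarrow> P x = x"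
    "\<And>x y. norm (P x - P y) \<le> 2 * norm (x - y)"
    using radial_truncation[OF R] by metis
  obtain l where l: "l-lipschitz_on (cball 0 R) g\<phi>" using g\<phi>_lip bounded_cball by blast
  obtain e where e: "e > 0" "\<And>t. t \<ge> 0 \<Longrightarrow> \<epsilon> t \<le> e" using \<epsilon>_bounded by blast
  \<comment> \<open>Truncating the argument of \<open>g\<phi>\<close> at radius \<open>R\<close> makes the field globally Lipschitz; the bound on
    \<open>V\<close> shows that the solution never reaches radius \<open>R\<close>.\<close>
  define F where "F = (\<lambda>t z. (snd z, - (\<gamma> *\<^sub>R snd z + g\<phi> (P (fst z)) + A (fst z) + \<epsilon> t *\<^sub>R g\<Theta> (fst z))))"
  \<comment> \<open>The leading 1 comes from the velocity component, the 2 from the Lipschitz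
    constant of \<open>P\<close>.\<close>
  define L where "L = 1 + (\<gamma> + l * 2 + 1 / lam + e * \<delta>)"
  have "l \<ge> 0" using l by (rule lipschitz_on_nonneg)
  have "L > 0" using \<gamma> \<open>l \<ge> 0\<close> lam e \<delta> by (simp add: L_def add_pos_nonneg)
  have P_cont: "continuous_on X P" for X
    by (rule lipschitz_on_continuous_on[of 2], rule lipschitz_onI) (use P(3) in \<open>auto simp: dist_norm\<close>)
  have F_cont: "continuous_on ({0..} \<times> UNIV) (\<lambda>(t, z). F t z)"
    unfolding F_def case_prod_beta
    by (intro continuous_intros continuous_on_compose2[OF g\<phi>_cont] continuous_on_compose2[OF A_cont]
        continuous_on_compose2[OF g\<Theta>_cont] continuous_on_compose2[OF P_cont]
        continuous_on_compose2[OF \<epsilon>_cont]) (auto intro!: continuous_intros)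
  have \<epsilon>t: "\<bar>\<epsilon> t\<bar> \<le> e" if "0 \<le> t" for t
    using \<epsilon>_pos[OF that] e(2)[OF that] by simp
  have F_lip: "norm (F t x - F t y) \<le> L * norm (x - y)" if "0 \<le> t" for t x y
  proof -
    define du dv n where "du = fst x - fst y" and "dv = snd x - snd y" and "n = norm (x - y)"
    have n: "norm du \<le> n" "norm dv \<le> n"
      using norm_fst_le[of "fst (x - y)" "snd (x - y)"] norm_snd_le[of "snd (x - y)" "fst (x - y)"]
        unfolding prod.collapse by (simp_all add: du_def dv_def n_def)
    have "n \<ge> 0" by (simp add: n_def)
    have 1: "norm (\<gamma> *\<^sub>R dv) \<le> \<gamma> * n" using n \<gamma> by simp
    have 2: "norm (g\<phi> (P (fst x)) - g\<phi> (P (fst y))) \<le> l * 2 * n"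
    proof -
      have "norm (g\<phi> (P (fst x)) - g\<phi> (P (fst y))) \<le> l * norm (P (fst x) - P (fst y))"
        using lipschitz_onD[OF l] P(1) by (simp add: dist_norm)
      also have "\<dots> \<le> l * (2 * n)"
        using P(3)[of "fst x" "fst y"] n \<open>l \<ge> 0\<close> by (intro mult_left_mono) (auto simp: du_def)
      finally show ?thesis by simp
    qed
    have 3: "norm (A (fst x) - A (fst y)) \<le> 1 / lam * n"
      using A_lip[of "fst x" "fst y"] n(1) lam mult_left_mono[of "norm du" n "1 / lam"]
      by (simp add: du_def)
    have 4: "norm (\<epsilon> t *\<^sub>R (g\<Theta> (fst x) - g\<Theta> (fst y))) \<le> e * \<delta> * n"
    proof -
      have "norm (\<epsilon> t *\<^sub>R (g\<Theta> (fst x) - g\<Theta> (fst y))) \<le> e * (\<delta> * n)"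
        unfolding norm_scaleR
      proof (intro mult_mono \<epsilon>t that)
        show "norm (g\<Theta> (fst x) - g\<Theta> (fst y)) \<le> \<delta> * n"
          using n(1) \<delta> by (intro order_trans[OF g\<Theta>_lip] mult_left_mono) (auto simp: du_def)
      qed (use e in auto)
      then show ?thesis by simp
    qed
    have "F t x - F t y = (dv, - (\<gamma> *\<^sub>R dv + (g\<phi> (P (fst x)) - g\<phi> (P (fst y)))
        + (A (fst x) - A (fst y)) + \<epsilon> t *\<^sub>R (g\<Theta> (fst x) - g\<Theta> (fst y))))"
      by (simp add: F_def dv_def algebra_simps)
    then have "norm (F t x - F t y) \<le> norm dv + norm (\<gamma> *\<^sub>R dv + (g\<phi> (P (fst x)) - g\<phi> (P (fst y)))
        + (A (fst x) - A (fst y)) + \<epsilon> t *\<^sub>R (g\<Theta> (fst x) - g\<Theta> (fst y)))"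
      using norm_Pair_le by (metis norm_minus_cancel)
    also have "\<dots> \<le> n + (\<gamma> * n + l * 2 * n + 1 / lam * n + e * \<delta> * n)"
      by (intro add_mono n(2) norm_triangle_le 1 2 3 4)
    also have "\<dots> = L * n" by (simp add: L_def algebra_simps)
    finally show ?thesis by (simp add: n_def)
  qed
  have F_zero: "norm (F t 0) \<le> norm (g\<phi> (P 0) + A 0) + e * norm (g\<Theta> 0)" if "0 \<le> t" for t
  proof -
    have "norm (F t 0) = norm (g\<phi> (P 0) + A 0 + \<epsilon> t *\<^sub>R g\<Theta> 0)"
      unfolding F_def norm_Pair by (simp only: fst_zero snd_zero norm_minus_cancel) simp
    also have "\<dots> \<le> norm (g\<phi> (P 0) + A 0) + e * norm (g\<Theta> 0)"
      using \<epsilon>t[OF that] by (intro norm_triangle_le add_left_mono) (auto intro: mult_right_mono)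
    finally show ?thesis .
  qed
  obtain z where z: "z 0 = (u0, v0)"
    "\<And>t. 0 \<le> t \<Longrightarrow> (z has_vector_derivative F t (z t)) (at t within {0..})"
    using global_lipschitz_ode_exists[OF F_cont F_lip F_zero \<open>L > 0\<close>, of "(u0, v0)"] by blast
  define u v where "u = (\<lambda>t. fst (z t))" and "v = (\<lambda>t. snd (z t))"
  have local_sol: "solves_on X u v" if "X \<subseteq> {0..}" "\<And>t. t \<in> X \<Longrightarrow> norm (u t) \<le> R" for X
    unfolding u_def v_def
  proof (rule solves_onI_fst_snd)
    fix t assume t: "t \<in> X"
    have "F t (z t) = (snd (z t), rhs (\<epsilon> t) (fst (z t)) (snd (z t)))"
      using that(2)[OF t] P(2) by (simp add: F_def rhs_def u_def)
    then show "(z has_vector_derivative (snd (z t), rhs (\<epsilon> t) (fst (z t)) (snd (z t)))) (at t within X)"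
      using z(2)[of t] t that(1) has_vector_derivative_within_subset by (metis atLeast_iff subsetD)
  qed
  have init: "u 0 = u0" "v 0 = v0" by (simp_all add: u_def v_def z(1))
  \<comment> \<open>Up to the first time at which the norm equals \<open>R\<close>, the truncated
    and original equations agree, so the bound on \<open>V\<close> applies and contradicts that
    equality.\<close>
  have "norm (u t) < R" if t: "t \<ge> 0" for t
  proof (rule ccontr)
    assume "\<not> norm (u t) < R"
    have "continuous_on {0..} z"
      using z(2) has_vector_derivative_continuous by (fastforce simp: continuous_on_eq_continuous_within)
    then have "continuous_on {0..t} (\<lambda>s. norm (u s))"
      unfolding u_def by (intro continuous_intros) (auto intro: continuous_on_subset)
    moreover have "norm (u 0) < R" "R \<le> norm (u t)"
      using \<open>\<not> norm (u t) < R\<close> init by (auto simp: R_def add_nonneg_pos)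
    ultimately obtain s where s: "s \<in> {0..t}" "norm (u s) = R"
      "\<And>r. r \<in> {0..s} \<Longrightarrow> norm (u r) \<le> R"
      using first_hitting_time[of t "\<lambda>s. norm (u s)" R] t by blast
    have "V p (u s) (v s) \<le> M"
      by (rule M) (use s init in \<open>auto intro: local_sol\<close>)
    then have "V p (u s) (v s) / k\<^sub>V \<le> M / k\<^sub>V"
      using k\<^sub>V_pos by (intro divide_right_mono) auto
    then have "(norm (u s - p))\<^sup>2 \<le> \<bar>M / k\<^sub>V\<bar>"
      using V_coercive[of "u s" p "v s"] by linarith
    then have "norm (u s - p) \<le> sqrt \<bar>M / k\<^sub>V\<bar>" by (rule real_le_rsqrt)
    then have "norm (u s) < R"
      using norm_triangle_sub[of "u s" p] norm_ge_zero[of u0] unfolding R_def by linarith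
    then show False using s(2) by simp
  qed
  then have "solves_on {0..} u v" by (intro local_sol) (auto intro: less_imp_le)
  then show ?thesis using that init by blast
qed

text \<open>Gronwall for \<open>|x|^2 + |y|^2\<close>, where \<open>x\<close> and \<open>y\<close>
  are the differences of positions and velocities. On \<open>{0..b}\<close> both trajectories are
  bounded, so \<open>g\<phi>\<close> has one Lipschitz constant for them.\<close>

lemma solution_unique:
  assumes sol: "solves_on {0..} u v" "solves_on {0..} u2 v2" and init: "u 0 = u2 0" "v 0 = v2 0"
    and "b \<ge> 0"
  shows "u b = u2 b"
proof -
  have s1: "solves_on {0..b} u v" and s2: "solves_on {0..b} u2 v2"
    using sol by (auto intro: solves_on_subset)
  have "continuous_on {0..b} u" "continuous_on {0..b} u2"
    using s1 s2 has_vector_derivative_continuous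
    unfolding solves_on_def continuous_on_eq_continuous_within by blast+
  then have "bounded (u ` {0..b} \<union> u2 ` {0..b})"
    by (intro bounded_Un[THEN iffD2] conjI compact_imp_bounded compact_continuous_image) auto
  then obtain l where l: "l-lipschitz_on (u ` {0..b} \<union> u2 ` {0..b}) g\<phi>"
    using g\<phi>_lip by blast
  have "l \<ge> 0" using l by (rule lipschitz_on_nonneg)
  obtain e where e: "e > 0" "\<And>t. t \<ge> 0 \<Longrightarrow> \<epsilon> t \<le> e" using \<epsilon>_bounded by blast
  define L where "L = 1 + (l + 1 / lam + e * \<delta>)"
  have "L \<ge> 0" using \<open>l \<ge> 0\<close> lam e \<delta> by (simp add: L_def)
  define x y w where "x = (\<lambda>t. u t - u2 t)" and "y = (\<lambda>t. v t - v2 t)"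
    and "w = (\<lambda>t. rhs (\<epsilon> t) (u t) (v t) - rhs (\<epsilon> t) (u2 t) (v2 t))"
  have dx: "(x has_vector_derivative y t) (at t within {0..b})"
    and dy: "(y has_vector_derivative w t) (at t within {0..b})" if "t \<in> {0..b}" for t
    using s1 s2 that unfolding solves_on_def x_def y_def w_def
    by (auto intro!: has_vector_derivative_diff)
  have "(x b \<bullet> x b + y b \<bullet> y b) * exp (- L * b) \<le> (x 0 \<bullet> x 0 + y 0 \<bullet> y 0) * exp (- L * 0)"
  proof (rule integrating_factor_decreasing[OF \<open>b \<ge> 0\<close>])
    fix t assume t: "t \<in> {0..b}"
    show "((\<lambda>t. x t \<bullet> x t + y t \<bullet> y t) has_real_derivative
        (x t \<bullet> y t + y t \<bullet> x t) + (y t \<bullet> w t + w t \<bullet> y t)) (at t within {0..b})"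
      by (intro DERIV_add has_real_derivative_inner dx[OF t] dy[OF t])
    show "((\<lambda>t. - L * t) has_real_derivative - L) (at t within {0..b})"
      by (auto intro!: derivative_eq_intros)
    have "norm (g\<phi> (u t) - g\<phi> (u2 t)) \<le> l * norm (x t)"
      using lipschitz_onD[OF l, of "u t" "u2 t"] t by (simp add: dist_norm x_def)
    moreover have "norm (A (u t) - A (u2 t)) \<le> 1 / lam * norm (x t)"
      unfolding x_def by (rule A_lip)
    moreover have "norm (\<epsilon> t *\<^sub>R (g\<Theta> (u t) - g\<Theta> (u2 t))) \<le> e * (\<delta> * norm (x t))"
      unfolding norm_scaleR x_def
      using e t \<epsilon>_pos[of t] by (intro mult_mono g\<Theta>_lip) auto
    ultimately have "norm ((g\<phi> (u t) - g\<phi> (u2 t)) + (A (u t) - A (u2 t)) + \<epsilon> t *\<^sub>R (g\<Theta> (u t) - g\<Theta> (u2 t)))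
        \<le> l * norm (x t) + 1 / lam * norm (x t) + e * (\<delta> * norm (x t))" (is "norm ?q \<le> _")
      by (intro norm_triangle_le add_mono)
    also have "\<dots> = (L - 1) * norm (x t)" by (simp add: L_def algebra_simps)
    finally have q: "norm ?q \<le> (L - 1) * norm (x t)" .
    \<comment> \<open>The damping contributes \<open>- \<gamma> |y|^2\<close>, which is dropped for
      its sign; the 1 in \<open>L\<close> accounts for \<open>x \<bullet> y\<close>.\<close>
    have "w t = - (\<gamma> *\<^sub>R y t) - ?q"
      by (simp add: w_def rhs_def y_def algebra_simps)
    then have "y t \<bullet> w t = - \<gamma> * (norm (y t))\<^sup>2 - y t \<bullet> ?q"
      by (simp add: inner_diff_right power2_norm_eq_inner)
    also have "\<dots> \<le> norm (y t) * ((L - 1) * norm (x t))"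
    proof -
      have "- (y t \<bullet> ?q) \<le> norm (y t) * norm ?q"
        using Cauchy_Schwarz_ineq2[of "y t" ?q] by linarith
      also have "\<dots> \<le> norm (y t) * ((L - 1) * norm (x t))"
        using q by (intro mult_left_mono) auto
      finally show ?thesis using \<gamma> by (smt (verit) mult_nonneg_nonneg zero_le_power2 mult_minus_left)
    qed
    finally have "x t \<bullet> y t + y t \<bullet> w t \<le> L * (norm (x t) * norm (y t))"
      using norm_cauchy_schwarz[of "x t" "y t"] by (simp add: algebra_simps)
    also have "\<dots> \<le> L * (((norm (x t))\<^sup>2 + (norm (y t))\<^sup>2) / 2)"
      using \<open>L \<ge> 0\<close> sum_squares_bound[of "norm (x t)" "norm (y t)"] by (intro mult_left_mono) auto
    finally show "(x t \<bullet> y t + y t \<bullet> x t) + (y t \<bullet> w t + w t \<bullet> y t) \<le> - (- L) * (x t \<bullet> x t + y t \<bullet> y t)"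
      by (simp add: power2_norm_eq_inner inner_commute algebra_simps)
  qed
  also have "\<dots> = 0" by (simp add: x_def y_def init)
  finally have "x b \<bullet> x b + y b \<bullet> y b \<le> 0"
    by (simp add: mult_le_0_iff)
  then have "x b \<bullet> x b = 0" using inner_ge_zero[of "x b"] inner_ge_zero[of "y b"] by linarith
  then show ?thesis by (simp add: x_def)
qed

text \<open>Passes to the first-order system; continuity of the second derivative then follows from
  continuity of the field.\<close>

lemma is_solution_iff:
  "is_solution \<gamma> g\<phi> A \<epsilon> g\<Theta> u0 v0 u \<longleftrightarrow> (\<exists>v. solves_on {0..} u v \<and> u 0 = u0 \<and> v 0 = v0)"
proof
  assume "is_solution \<gamma> g\<phi> A \<epsilon> g\<Theta> u0 v0 u"
  then obtain v w where
    u: "\<And>t. t \<ge> 0 \<Longrightarrow> (u has_vector_derivative v t) (at t within {0..})" and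
    v: "\<And>t. t \<ge> 0 \<Longrightarrow> (v has_vector_derivative w t) (at t within {0..})" and
    eq: "\<And>t. t \<ge> 0 \<Longrightarrow> w t + \<gamma> *\<^sub>R v t + g\<phi> (u t) + A (u t) + \<epsilon> t *\<^sub>R g\<Theta> (u t) = 0" and
    init: "u 0 = u0" "v 0 = v0"
    unfolding is_solution_def by blast
  have "w t = rhs (\<epsilon> t) (u t) (v t)" if "t \<ge> 0" for t
    using eq[OF that] unfolding rhs_def eq_neg_iff_add_eq_0 by (simp add: add.assoc)
  then have "solves_on {0..} u v" using u v by (simp add: solves_on_def)
  then show "\<exists>v. solves_on {0..} u v \<and> u 0 = u0 \<and> v 0 = v0" using init by blast
next
  assume "\<exists>v. solves_on {0..} u v \<and> u 0 = u0 \<and> v 0 = v0"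
  then obtain v where s: "solves_on {0..} u v" and init: "u 0 = u0" "v 0 = v0" by blast
  have "continuous_on {0..} u" "continuous_on {0..} v"
    using s has_vector_derivative_continuous
    unfolding solves_on_def continuous_on_eq_continuous_within by blast+
  then have "continuous_on {0..} (\<lambda>t. rhs (\<epsilon> t) (u t) (v t))"
    unfolding rhs_def
    by (intro continuous_intros \<epsilon>_cont continuous_on_compose2[OF g\<phi>_cont[of UNIV]]
        continuous_on_compose2[OF A_cont[of UNIV]] continuous_on_compose2[OF g\<Theta>_cont[of UNIV]]) auto
  then show "is_solution \<gamma> g\<phi> A \<epsilon> g\<Theta> u0 v0 u"
    unfolding is_solution_def using s init
    by (intro exI[of _ v] exI[of _ "\<lambda>t. rhs (\<epsilon> t) (u t) (v t)"])
      (auto simp: solves_on_def, simp add: rhs_def)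
qed

end

theorem theorem3p1:
  fixes \<phi> \<Theta> :: "'a::{real_inner, banach} \<Rightarrow> real"
    and g\<phi> g\<Theta> A :: "'a \<Rightarrow> 'a"
    and \<epsilon> :: "real \<Rightarrow> real"
    and \<gamma> lam \<delta> \<eta> :: real
    and S :: "'a set"
  assumes "\<gamma> > 0"
    and "convex_on UNIV \<phi>"
    and "\<And>x. GDERIV \<phi> x :> g\<phi> x"
    and "\<And>B. bounded B \<Longrightarrow> \<exists>L. L-lipschitz_on B g\<phi>"
    and "maximal_monotone A"
    and "cocoercive lam A"
    and "\<And>t. t \<ge> 0 \<Longrightarrow> \<epsilon> t > 0"
    and "C1_halfline \<epsilon>"
    and "(\<epsilon> \<longlongrightarrow> 0) at_top"
    and "\<And>x. GDERIV \<Theta> x :> g\<Theta> x"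
    and "convex_on UNIV \<Theta>"
    and "bdd_below (range \<Theta>)"
    and "\<delta> > 0"
    and "\<eta> > 0"
    and "\<And>u v. norm (g\<Theta> u - g\<Theta> v) \<le> \<delta> * norm (u - v)"
    and "\<And>u v. (g\<Theta> u - g\<Theta> v) \<bullet> (u - v) \<ge> \<eta> * (norm (u - v))\<^sup>2"
    and "S = {v. A v + g\<phi> v = 0}"
    and "S \<noteq> {}"
    and "lam * \<gamma>\<^sup>2 > 1"
    and "antimono_on {0..} \<epsilon>"
    and "filterlim (\<lambda>T. integral {0..T} \<epsilon>) at_top at_top"
  shows "(\<exists>!u_star. solves_VI g\<Theta> S u_star) \<and>
    (\<forall>u0 v0. \<exists>u.
       is_solution \<gamma> g\<phi> A \<epsilon> g\<Theta> u0 v0 u \<and>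
       (\<forall>w. is_solution \<gamma> g\<phi> A \<epsilon> g\<Theta> u0 v0 w \<longrightarrow> (\<forall>t\<ge>0. w t = u t)) \<and>
       (\<forall>u_star. solves_VI g\<Theta> S u_star \<longrightarrow> (u \<longlongrightarrow> u_star) at_top))"
proof -
  have \<epsilon>_cont: "continuous_on {0..} \<epsilon>"
    using \<open>C1_halfline \<epsilon>\<close> DERIV_continuous
    unfolding C1_halfline_def continuous_on_eq_continuous_within by fastforce
  interpret damped_inclusion \<phi> g\<phi> g\<Theta> A \<epsilon> \<gamma> lam \<delta> \<eta>
    by (unfold_locales; (rule assms \<epsilon>_cont; assumption?))
  have S: "S = {v. T v = 0}" using assms(17) by (simp add: T_def)
  have E: "filterlim E at_top at_top"
    using assms(21) by (simp add: E_def[abs_def])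
  have "\<exists>x. solves_VI g\<Theta> S x"
    using assms(18) unfolding S
    by (intro variational_inequality_exists[OF closed_zeros convex_zeros _ assms(10-12) g\<Theta>_cont \<eta> g\<Theta>_strong])
  then have VI: "\<exists>!x. solves_VI g\<Theta> S x"
    using variational_inequality_unique[OF \<eta> g\<Theta>_strong] by blast
  moreover have "\<exists>u. is_solution \<gamma> g\<phi> A \<epsilon> g\<Theta> u0 v0 u \<and>
       (\<forall>w. is_solution \<gamma> g\<phi> A \<epsilon> g\<Theta> u0 v0 w \<longrightarrow> (\<forall>t\<ge>0. w t = u t)) \<and>
       (\<forall>u_star. solves_VI g\<Theta> S u_star \<longrightarrow> (u \<longlongrightarrow> u_star) at_top)" for u0 v0
  proof -
    \<comment> \<open>Any zero of \<open>T\<close> provides the bound needed for existence; the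
      solution of the variational inequality enters only in the convergence.\<close>
    obtain p where "T p = 0" using assms(18) S by auto
    then obtain u v where uv: "u 0 = u0" "v 0 = v0" "solves_on {0..} u v"
      using solution_exists by blast
    show ?thesis
    proof (intro exI[of _ u] conjI allI impI)
      show "is_solution \<gamma> g\<phi> A \<epsilon> g\<Theta> u0 v0 u" using uv by (auto simp: is_solution_iff)
      show "w t = u t" if "is_solution \<gamma> g\<phi> A \<epsilon> g\<Theta> u0 v0 w" "0 \<le> t" for w t
        using that uv solution_unique unfolding is_solution_iff by metis
      show "(u \<longlongrightarrow> x) at_top" if "solves_VI g\<Theta> S x" for x
        using solution_tendsto[OF _ uv(3) E] that S by simp
    qed
  qed
  ultimately show ?thesis by blast
qed

end
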